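(* Let $0<s\le 1$ be given. There exist (i) a nowhere dense compact Cantor type subset $E_s\subset[0,1]$ with $\mathcal{H}^s(E_s)=1$ if $0<s<1$, and $\dim_{\mathcal{H}}(E_1)=1$ if $s=1$; (ii) holomorphic functions $F(z)$, $G(z)$ on $\mathbb{C}_+$, with $G$ not identically zero, such that $f(z)=e^{-F(z)}$ and $g(z)=G(z)e^{-F(z)}$ admit $C^\infty$-extensions to $\overline{\mathbb{C}_+}$. Moreover, $f$ and $g$ vanish to infinite order at every $z\in -iE_s$, and for every $z\in -iE_s$ there is a sequence $z_k\in\mathbb{C}_+$ with $z_k\to z$ and $g(z_k)=0$ for all $k$.
   Context: $\mathbb{C}_+=\{z\in\mathbb{C}: \Re(z)>0\}$, $\overline{\mathbb{C}_+}$ is its closure, and $-iE_s=\{-iy: y\in E_s\}\subset\partial\mathbb{C}_+$. $\mathcal{H}^s$ is the unnormalised Hausdorff measure: $\mathcal{H}^s(E)=\sup_{\delta>0}\mathcal{H}^s_\delta(E)$, where $\mathcal{H}^s_\delta(E)=\inf\sum_{j}\operatorname{diam}(U_j)^s$, the infimum being over countable covers $\{U_j\}$ of $E$ with $\operatorname{diam}(U_j)<\delta$. $\dim_{\mathcal{H}}$ is the Hausdorff dimension. "Cantor type" means that $E_s=\bigcap_{k\ge1}\bigcup_{l=1}^{2^k}E_{k,l}$, where $E_{0,1}=[0,1]$ and, inductively, $E_{k,2l-1},E_{k,2l}$ are the two disjoint closed intervals of equal length obtained by removing an open interval from the middle of the compact interval $E_{k-1,l}$. A holomorphic function on $\mathbb{C}_+$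 admits a $C^\infty$-extension to $\overline{\mathbb{C}_+}$ if it and all its complex derivatives extend continuously to $\overline{\mathbb{C}_+}$; it vanishes to infinite order at a boundary point $z$ if the extended function and all its extended derivatives are zero at $z$. *)

theory Defs
  imports "HOL-Complex_Analysis.Complex_Analysis"
begin

definition right_half_plane :: "complex set" where
  "right_half_plane = {z. Re z > 0}"

definition nowhere_dense :: "'a::topological_space set \<Rightarrow> bool" where
  "nowhere_dense S \<longleftrightarrow> interior (closure S) = {}"

text \<open>The quantity diam(U)^s, for bounded U and s \<ge> 0. The empty set has weight 0, so that
  sequences of sets also represent finite covers. A nonempty set has weight 1 for s = 0,
  whereas \<open>0 powr 0 = 0\<close>.\<close>

definition diam_power :: "real \<Rightarrow> 'a::metric_space set \<Rightarrow> ennreal" where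
  "diam_power s U =
     (if U = {} then 0 else if s = 0 then 1 else ennreal (diameter U powr s))"

text \<open>Boundedness is stated separately, since \<^const>\<open>diameter\<close> is real-valued and carries no
  information on unbounded sets.\<close>

definition hausdorff_premeasure :: "real \<Rightarrow> real \<Rightarrow> 'a::metric_space set \<Rightarrow> ennreal" where
  "hausdorff_premeasure s \<delta> E =
     Inf {(\<Sum>j. diam_power s (U j)) | U :: nat \<Rightarrow> 'a set.
            E \<subseteq> (\<Union>j. U j) \<and> (\<forall>j. bounded (U j) \<and> diameter (U j) < \<delta>)}"

definition hausdorff_measure :: "real \<Rightarrow> 'a::metric_space set \<Rightarrow> ennreal" where
  "hausdorff_measure s E = (SUP \<delta>\<in>{0<..}. hausdorff_premeasure s \<delta> E)"

definition hausdorff_dim :: "'a::metric_space set \<Rightarrow> ereal" where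
  "hausdorff_dim E = Inf {ereal s | s. 0 \<le> s \<and> hausdorff_measure s E = 0}"

text \<open>The children of \<open>{p..t}\<close> arise by removing the open middle interval \<open>{q<..<r}\<close>. They are
  nondegenerate, since otherwise the construction could not be continued. Only
  the two children of the same interval are required to have equal length.\<close>

definition cantor_type :: "real set \<Rightarrow> bool" where
  "cantor_type C \<longleftrightarrow>
     (\<exists>E :: nat \<Rightarrow> nat \<Rightarrow> real set.
        E 0 1 = {0..1} \<and>
        (\<forall>k\<ge>1. \<forall>l\<in>{1..2^(k - 1)}. \<exists>p q r t.
           p < q \<and> q < r \<and> r < t \<and> q - p = t - r \<and>
           E (k - 1) l = {p..t} \<and> E k (2*l - 1) = {p..q} \<and> E k (2*l) = {r..t}) \<and>
        C = (\<Inter>k\<in>{1..}. \<Union>l\<in>{1..2^k}. E k l))"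

text \<open>\<open>h n\<close> is a continuous extension of the \<open>n\<close>-th complex derivative of \<open>f\<close> to the closed
  half-plane. It is uniquely determined there by \<open>f\<close>.\<close>

definition smooth_extension :: "(complex \<Rightarrow> complex) \<Rightarrow> (nat \<Rightarrow> complex \<Rightarrow> complex) \<Rightarrow> bool" where
  "smooth_extension f h \<longleftrightarrow>
     f holomorphic_on right_half_plane \<and>
     (\<forall>n. continuous_on (closure right_half_plane) (h n) \<and>
          (\<forall>z\<in>right_half_plane. h n z = (deriv ^^ n) f z))"

definition admits_smooth_extension :: "(complex \<Rightarrow> complex) \<Rightarrow> bool" where
  "admits_smooth_extension f \<longleftrightarrow> (\<exists>h. smooth_extension f h)"

definition vanishes_to_infinite_order :: "(complex \<Rightarrow> complex) \<Rightarrow> complex \<Rightarrow> bool" where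
  "vanishes_to_infinite_order f z \<longleftrightarrow>
     z \<in> frontier right_half_plane \<and> (\<exists>h. smooth_extension f h \<and> (\<forall>n. h n z = 0))"

end

theory Submission
  imports Defs "HOL-Real_Asymp.Real_Asymp"
begin

text \<open>
  Let \<open>E\<close> be a Cantor set with pieces of length \<open>l k\<close> at level \<open>k\<close>, and let \<open>X t\<close> be its point with
  address \<open>t \<in> [0, 1)\<close>. If \<open>\<bar>t - u\<bar> \<le> C \<bar>X t - X u\<bar>^s\<close>, then any cover of \<open>E\<close> pulls back to one of
  \<open>[0, 1)\<close>, so subadditivity of Lebesgue measure gives \<open>H^s(E) \<ge> 1 / C\<close>. For \<open>l k = 2^(-k/s)\<close>
  the inequality holds with \<open>C = 1\<close>, by self-similarity and concavity of \<open>x^s\<close>; for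
  \<open>l k = 2^(-k) / (k + 1)^3\<close> it holds for every exponent below 1, with a constant depending on it.

  Let \<open>F\<close> be the sum of \<open>(k + 1) l k / (z + i a + l k)\<close> over all left end points \<open>a\<close> of pieces of level
  \<open>k\<close>. Near \<open>-iE\<close> its real part grows at least like the square of the logarithm of the distance, so
  \<open>exp (- F)\<close> is smaller than any power of the distance. Let \<open>G\<close> be a Blaschke product whose zeros
  accumulate at every point of \<open>-iE\<close>. Both estimates survive on slightly larger discs that
  cross the boundary, and Cauchy's inequality then makes all derivatives of \<open>exp (- F)\<close> and
  \<open>G exp (- F)\<close> Lipschitz on the half-plane and zero on \<open>-iE\<close>.
\<close>

section \<open>Hausdorff measure of Cantor sets\<close>

text \<open>Preimages under \<open>X\<close> turn a cover of \<open>E\<close> into a cover of [0,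
  1). By \<open>holder\<close>, the preimage of \<open>U j\<close> has spread at most
  \<open>C * diameter (U j) powr s\<close>. Since it may be nonmeasurable, it is enclosed in an
  interval \<open>W j\<close> of that length before Lebesgue measure is applied.\<close>

lemma hausdorff_measure_ge_if_holder_surj:
  fixes X :: "real \<Rightarrow> 'a::metric_space"
  assumes XE: "\<And>t. 0 \<le> t \<Longrightarrow> t < 1 \<Longrightarrow> X t \<in> E"
    and holder: "\<And>t u. 0 \<le> t \<Longrightarrow> t < u \<Longrightarrow> u < 1 \<Longrightarrow> u - t \<le> C * dist (X t) (X u) powr s"
    and C: "C > 0" and s: "s \<ge> 0"
  shows "hausdorff_measure s E \<ge> ennreal (1 / C)"
proof -
  have cover: "ennreal (1 / C) \<le> (\<Sum>j. diam_power s (U j))"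
    if U: "E \<subseteq> (\<Union>j. U j)" "\<And>j. bounded (U j)" for U :: "nat \<Rightarrow> 'a set"
  proof -
    define V where "V j = {t. 0 \<le> t \<and> t < 1 \<and> X t \<in> U j}" for j
    define D where "D j = C * diameter (U j) powr s" for j
    define W where "W j = (if V j = {} then {} else {Inf (V j)..Inf (V j) + D j})" for j
    have bdd: "bdd_below (V j)" for j
      unfolding V_def by (rule bdd_belowI[of _ 0]) auto
    have close: "t \<le> u + D j" if "t \<in> V j" "u \<in> V j" for t u j
    proof (cases "u < t")
      case True
      have "t - u \<le> C * dist (X u) (X t) powr s"
        using that True by (intro holder) (auto simp: V_def)
      also have "\<dots> \<le> D j"
        unfolding D_def using that U(2) C s
        by (intro mult_left_mono powr_mono2 diameter_bounded_bound) (auto simp: V_def)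
      finally show ?thesis by simp
    next
      case False
      moreover have "D j \<ge> 0"
        using C by (simp add: D_def)
      ultimately show ?thesis by simp
    qed
    have VW: "V j \<subseteq> W j" for j
    proof
      fix t assume t: "t \<in> V j"
      have "t - D j \<le> Inf (V j)"
        using t close[OF t] by (intro cInf_greatest) (auto simp: algebra_simps)
      then show "t \<in> W j"
        using t cInf_lower[OF t bdd] by (auto simp: W_def)
    qed
    have W_le: "emeasure lborel (W j) \<le> ennreal C * diam_power s (U j)" for j
    proof (cases "V j = {}")
      case False
      then have "U j \<noteq> {}"
        by (auto simp: V_def)
      \<comment> \<open>Only an inequality: for \<open>s = 0\<close> and diameter 0 the left side is
        \<open>0 powr 0 = 0\<close>, while the weight of a nonempty set is 1.\<close>
      then have "ennreal (diameter (U j) powr s) \<le> diam_power s (U j)"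
        by (auto simp: diam_power_def powr_def)
      moreover have "emeasure lborel (W j) = ennreal C * ennreal (diameter (U j) powr s)"
        using False C by (simp add: W_def D_def ennreal_mult)
      ultimately show ?thesis
        by (simp add: mult_left_mono)
    qed (simp add: W_def)
    have meas: "range W \<subseteq> sets lborel"
      by (auto simp: W_def)
    have "{0..<1} \<subseteq> (\<Union>j. W j)"
    proof
      fix t :: real assume t: "t \<in> {0..<1}"
      then obtain j where "X t \<in> U j"
        using XE U(1) by fastforce
      then have "t \<in> V j"
        using t by (simp add: V_def)
      then show "t \<in> (\<Union>j. W j)"
        using VW by blast
    qed
    then have "emeasure lborel {0..<1::real} \<le> emeasure lborel (\<Union>j. W j)"
      using meas by (intro emeasure_mono) auto
    also have "\<dots> \<le> (\<Sum>j. emeasure lborel (W j))"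
      using meas by (rule emeasure_subadditive_countably)
    also have "\<dots> \<le> (\<Sum>j. ennreal C * diam_power s (U j))"
      by (intro suminf_le W_le) auto
    finally have "1 \<le> ennreal C * (\<Sum>j. diam_power s (U j))"
      by simp
    then show ?thesis
    proof (cases "\<Sum>j. diam_power s (U j)")
      case (real y)
      then show ?thesis
        using \<open>1 \<le> ennreal C * _\<close> C
        by (simp add: ennreal_mult[symmetric] ennreal_1[symmetric] field_simps del: ennreal_1)
    qed simp
  qed
  \<comment> \<open>The bound holds for covers of any mesh, so a single mesh, here 1, bounds the
    supremum from below.\<close>
  have "ennreal (1 / C) \<le> hausdorff_premeasure s 1 E"
    unfolding hausdorff_premeasure_def by (intro Inf_greatest) (use cover in auto)
  also have "\<dots> \<le> hausdorff_measure s E"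
    unfolding hausdorff_measure_def by (intro SUP_upper) auto
  finally show ?thesis .
qed

section \<open>Cantor sets with prescribed interval lengths\<close>

locale cantor_lengths =
  fixes l :: "nat \<Rightarrow> real"
  assumes l_0: "l 0 = 1" and l_pos: "\<And>k. 0 < l k" and l_Suc: "\<And>k. 2 * l (Suc k) < l k"
begin

text \<open>The \<open>k\<close> lowest binary digits of \<open>i\<close>, most significant first,
  record the choices of left or right child on levels 1 to \<open>k\<close>. Thus piece
  \<open>i\<close> has the children \<open>2 * i\<close> and \<open>2 * i + 1\<close>.\<close>

fun left_end :: "nat \<Rightarrow> nat \<Rightarrow> real" where
  "left_end 0 i = 0"
| "left_end (Suc k) i = left_end k (i div 2) + of_nat (i mod 2) * (l k - l (Suc k))"

definition piece :: "nat \<Rightarrow> nat \<Rightarrow> real set" where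
  "piece k i = {left_end k i..left_end k i + l k}"

definition stage :: "nat \<Rightarrow> real set" where
  "stage k = (\<Union>i<2 ^ k. piece k i)"

definition cantor_set :: "real set" where
  "cantor_set = (\<Inter>k. stage k)"

lemma piece_Suc_subset: "piece (Suc k) i \<subseteq> piece k (i div 2)"
proof -
  have "i mod 2 = 0 \<or> i mod 2 = 1"
    by auto
  then show ?thesis
    using l_pos[of "Suc k"] l_Suc[of k] by (auto simp: piece_def)
qed

lemma stage_Suc_subset: "stage (Suc k) \<subseteq> stage k"
proof
  fix x assume "x \<in> stage (Suc k)"
  then obtain i where i: "i < 2 ^ Suc k" "x \<in> piece (Suc k) i"
    by (auto simp: stage_def)
  then show "x \<in> stage k"
    using piece_Suc_subset[of k i] by (auto simp: stage_def intro!: bexI[of _ "i div 2"])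
qed

lemma stage_antimono: "m \<le> k \<Longrightarrow> stage k \<subseteq> stage m"
  by (rule lift_Suc_antimono_le[where f = stage, OF stage_Suc_subset])

text \<open>Appending \<open>m\<close> zero digits means choosing the left child \<open>m\<close>
  times, which keeps the left end fixed. Hence left ends survive in all later stages.\<close>

lemma left_end_shift: "left_end (k + m) (i * 2 ^ m) = left_end k i"
proof (induction m)
  case (Suc m)
  have "i * 2 ^ Suc m div 2 = i * 2 ^ m" "i * 2 ^ Suc m mod 2 = 0"
    by simp_all
  then show ?case
    using Suc by (simp only: add_Suc_right left_end.simps of_nat_0 mult_zero_left add_0_right)
qed simp

lemma left_end_in_cantor_set:
  assumes "i < 2 ^ k"
  shows "left_end k i \<in> cantor_set"
  unfolding cantor_set_def
proof
  fix m
  have "left_end k i \<in> stage (k + m)" for m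
    using assms left_end_shift[of k m i] l_pos[of "k + m"]
    by (auto simp: stage_def piece_def power_add intro!: bexI[of _ "i * 2 ^ m"])
  then show "left_end k i \<in> stage m"
    using stage_antimono[of m "k + m"] by auto
qed

text \<open>The left ends of level \<open>k\<close> will carry the poles of \<open>F\<close>; this
  places one of them within \<open>l k\<close> of any point of the Cantor set.\<close>

lemma cantor_set_net:
  assumes "y \<in> cantor_set"
  shows "\<exists>i<2 ^ k. \<bar>y - left_end k i\<bar> \<le> l k"
proof -
  obtain i where "i < 2 ^ k" "y \<in> piece k i"
    using assms by (auto simp: cantor_set_def stage_def)
  then show ?thesis
    by (intro exI[of _ i]) (auto simp: piece_def)
qed

lemma stage_0: "stage 0 = {0..1}"
  by (simp add: stage_def piece_def l_0 lessThan_Suc)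

lemma cantor_set_subset: "cantor_set \<subseteq> {0..1}"
  using stage_0 by (auto simp: cantor_set_def)

lemma compact_cantor_set: "compact cantor_set"
proof -
  have "closed cantor_set"
    unfolding cantor_set_def stage_def piece_def by (intro closed_INT closed_UN ballI) auto
  then show ?thesis
    using cantor_set_subset bounded_closed_interval bounded_subset compact_eq_bounded_closed by blast
qed

lemma cantor_type_cantor_set: "cantor_type cantor_set"
  unfolding cantor_type_def
\<comment> \<open>\<open>cantor_type\<close> counts intervals from 1, \<open>piece\<close> from 0;
  the shift turns the children \<open>2 * j - 1\<close> and \<open>2 * j\<close> into
  \<open>2 * i\<close> and \<open>2 * i + 1\<close>.\<close>
proof (intro exI[of _ "\<lambda>k j. piece k (j - 1)"] conjI allI impI ballI)
  show "piece 0 (1 - 1) = {0..1}"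
    by (simp add: piece_def l_0)
next
  fix k j :: nat
  assume "k \<ge> 1" and j: "j \<in> {1..2 ^ (k - 1)}"
  then obtain m where k: "k = Suc m"
    by (cases k) auto
  obtain i where i: "j = Suc i"
    using j by (cases j) auto
  let ?a = "left_end m i"
  show "\<exists>p q r t. p < q \<and> q < r \<and> r < t \<and> q - p = t - r \<and> piece (k - 1) (j - 1) = {p..t} \<and>
      piece k (2 * j - 1 - 1) = {p..q} \<and> piece k (2 * j - 1) = {r..t}"
    using l_pos[of k] l_Suc[of m]
    by (intro exI[of _ ?a] exI[of _ "?a + l k"] exI[of _ "?a + l m - l k"] exI[of _ "?a + l m"])
      (auto simp: k i piece_def)
next
  have "(\<Union>j\<in>{1..2 ^ k}. piece k (j - 1)) = stage k" for k
  proof -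
    have "{..<2 ^ k} = (\<lambda>j. j - 1) ` {1..(2::nat) ^ k}"
      by (force simp: image_iff intro!: bexI[of _ "Suc _"])
    then show ?thesis
      by (simp add: stage_def)
  qed
  \<comment> \<open>\<open>cantor_type\<close> intersects from level 1 on; level 0 can be added
    because the stages decrease.\<close>
  moreover have "cantor_set = (\<Inter>k\<in>{1..}. stage k)"
  proof
    show "(\<Inter>k\<in>{1..}. stage k) \<subseteq> cantor_set"
      unfolding cantor_set_def
    proof
      fix x assume x: "x \<in> (\<Inter>k\<in>{1..}. stage k)"
      have "x \<in> stage k" for k
        using x stage_Suc_subset[of k] by force
      then show "x \<in> (\<Inter>k. stage k)"
        by blast
    qed
  qed (auto simp: cantor_set_def)
  ultimately show "cantor_set = (\<Inter>k\<in>{1..}. \<Union>j\<in>{1..2 ^ k}. piece k (j - 1))"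
    by simp
qed

text \<open>Stage \<open>k\<close> consists of \<open>2 ^ k\<close> intervals of length
  \<open>l k\<close>, so its measure is at most \<open>2 ^ k * l k\<close>.\<close>

lemma negligible_cantor_set:
  assumes "(\<lambda>k. 2 ^ k * l k) \<longlonglongrightarrow> 0"
  shows "negligible cantor_set"
  unfolding negligible_outer_le
proof (intro allI impI)
  fix e :: real assume "e > 0"
  then have "\<forall>\<^sub>F k in sequentially. 2 ^ k * l k < e"
    using assms by (rule order_tendstoD(2)[rotated])
  then obtain k where k: "2 ^ k * l k < e"
    using eventually_happens by force
  have piece: "piece k i \<in> lmeasurable" "measure lebesgue (piece k i) = l k" for i
    using l_pos[of k] by (simp_all add: piece_def)
  have "measure lebesgue (stage k) \<le> (\<Sum>i<(2::nat) ^ k. measure lebesgue (piece k i))"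
    unfolding stage_def by (intro measure_UNION_le) (auto simp: piece_def)
  also have "\<dots> \<le> e"
    using k piece(2) by simp
  finally show "\<exists>T. cantor_set \<subseteq> T \<and> T \<in> lmeasurable \<and> measure lebesgue T \<le> e"
    using piece(1) by (intro exI[of _ "stage k"]) (auto simp: cantor_set_def stage_def intro!: fmeasurable.finite_UN)
qed

lemma nowhere_dense_cantor_set:
  assumes "(\<lambda>k. 2 ^ k * l k) \<longlonglongrightarrow> 0"
  shows "nowhere_dense cantor_set"
proof -
  have "closure cantor_set = cantor_set"
    using compact_cantor_set compact_imp_closed closure_closed by blast
  moreover have "interior cantor_set = {}"
    using negligible_cantor_set[OF assms] negligible_subset interior_subset open_interior open_not_negligible
    by metis
  ultimately show ?thesis
    by (simp add: nowhere_dense_def)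
qed

lemma l_le_half_power: "l k \<le> (1 / 2) ^ k"
proof (induction k)
  case (Suc k)
  then show ?case
    using l_Suc[of k] by simp
qed (simp add: l_0)

text \<open>The pieces of level \<open>k\<close> form a cover of total weight
  \<open>2 ^ k * l k powr s\<close>, admissible for mesh \<delta> as soon as \<open>l k\<close> is
  below \<delta>. Letting \<open>k\<close> grow bounds every premeasure by the limit.\<close>

lemma hausdorff_measure_cantor_set_le:
  assumes s: "s > 0" and lim: "(\<lambda>k. 2 ^ k * l k powr s) \<longlonglongrightarrow> c"
  shows "hausdorff_measure s cantor_set \<le> ennreal c"
  unfolding hausdorff_measure_def
proof (rule SUP_least)
  fix \<delta> :: real assume "\<delta> \<in> {0<..}"
  then have \<delta>: "\<delta> > 0"
    by simp
  have l_lim: "l \<longlonglongrightarrow> 0"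
    by (rule real_tendsto_sandwich[OF _ _ tendsto_const LIMSEQ_realpow_zero[of "1 / 2"]])
      (auto intro: always_eventually less_imp_le[OF l_pos] l_le_half_power)
  have premeasure: "hausdorff_premeasure s \<delta> cantor_set \<le> ennreal (2 ^ k * l k powr s)" if k: "l k < \<delta>" for k
  proof -
    define U where "U j = (if j < 2 ^ k then piece k j else {})" for j
    have diam: "diameter (piece k j) = l k" for j
      using l_pos[of k] by (simp add: piece_def diameter_closed_interval)
    have "cantor_set \<subseteq> (\<Union>j. U j)"
      by (force simp: cantor_set_def stage_def U_def)
    moreover have "bounded (U j) \<and> diameter (U j) < \<delta>" for j
      using diam k \<delta> by (auto simp: U_def piece_def)
    ultimately have "hausdorff_premeasure s \<delta> cantor_set \<le> (\<Sum>j. diam_power s (U j))"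
      unfolding hausdorff_premeasure_def by (intro Inf_lower) blast
    also have "\<dots> = (\<Sum>j<2 ^ k. diam_power s (U j))"
      by (intro suminf_finite) (auto simp: U_def diam_power_def)
    also have "\<dots> = (\<Sum>j<(2::nat) ^ k. ennreal (l k powr s))"
      using s l_pos[of k] diam by (intro sum.cong) (auto simp: U_def diam_power_def piece_def)
    also have "\<dots> = ennreal (2 ^ k * l k powr s)"
      by (simp add: ennreal_mult flip: ennreal_power)
    finally show ?thesis .
  qed
  have "\<forall>\<^sub>F k in sequentially. hausdorff_premeasure s \<delta> cantor_set \<le> ennreal (2 ^ k * l k powr s)"
    using order_tendstoD(2)[OF l_lim \<delta>] by (rule eventually_mono[OF _ premeasure])
  moreover have "(\<lambda>k. ennreal (2 ^ k * l k powr s)) \<longlonglongrightarrow> ennreal c"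
    by (intro tendsto_ennrealI lim)
  ultimately show "hausdorff_premeasure s \<delta> cantor_set \<le> ennreal c"
    by (intro tendsto_lowerbound) auto
qed

section \<open>Parametrisation of the Cantor set by binary digits\<close>

text \<open>\<open>address k t\<close> consists of the first \<open>k\<close> binary digits of \<open>t\<close>, so that \<open>cantor_point\<close> below is a
  right inverse of the Cantor function.\<close>

definition address :: "nat \<Rightarrow> real \<Rightarrow> nat" where
  "address k t = nat \<lfloor>2 ^ k * t\<rfloor>"

lemma address_Suc_div_2: "address (Suc k) t div 2 = address k t"
proof -
  have "\<lfloor>2 ^ k * t\<rfloor> = \<lfloor>(2 ^ Suc k * t) / of_int 2\<rfloor>"
    by simp
  also have "\<dots> = \<lfloor>2 ^ Suc k * t\<rfloor> div 2"
    by (rule floor_divide_real_eq_div) simp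
  finally show ?thesis
    by (simp add: address_def nat_div_distrib')
qed

lemma address_less:
  assumes "t < 1"
  shows "address k t < 2 ^ k"
proof -
  have "2 ^ k * t < 2 ^ k"
    using assms by simp
  then have "\<lfloor>2 ^ k * t\<rfloor> < 2 ^ k"
    by (simp add: floor_less_iff)
  then show ?thesis
    by (simp add: address_def nat_less_iff)
qed

lemma address_bounds:
  assumes "0 \<le> t"
  shows "real (address k t) / 2 ^ k \<le> t" "t < (real (address k t) + 1) / 2 ^ k"
proof -
  have "real (address k t) = of_int \<lfloor>2 ^ k * t\<rfloor>"
    using assms by (simp add: address_def)
  then show "real (address k t) / 2 ^ k \<le> t" "t < (real (address k t) + 1) / 2 ^ k"
    by (simp_all add: field_simps) linarith+
qed

lemma piece_address_antimono:
  assumes "k \<le> m"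
  shows "piece m (address m t) \<subseteq> piece k (address k t)"
proof -
  have "piece (Suc k) (address (Suc k) t) \<subseteq> piece k (address k t)" for k
    using piece_Suc_subset[of k "address (Suc k) t"] by (simp only: address_Suc_div_2)
  then show ?thesis
    using assms by (rule lift_Suc_antimono_le[where f = "\<lambda>k. piece k (address k t)"])
qed

definition cantor_point :: "real \<Rightarrow> real" where
  "cantor_point t = (SUP k. left_end k (address k t))"

text \<open>The pieces addressed by \<open>t\<close> are nested, so each of their left ends lies
  below each of their right ends. The supremum of the left ends therefore lies in all of
  them.\<close>

lemma cantor_point_in_piece: "cantor_point t \<in> piece k (address k t)"
proof -
  have le: "left_end m (address m t) \<le> left_end n (address n t) + l n" for m n
  proof -
    have "left_end (max m n) (address (max m n) t) \<in> piece (max m n) (address (max m n) t)"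
         "left_end m (address m t) \<in> piece m (address m t)"
      using l_pos less_imp_le by (auto simp: piece_def)
    then have "left_end (max m n) (address (max m n) t) \<in> piece m (address m t) \<inter> piece n (address n t)"
      using piece_address_antimono[of m "max m n" t] piece_address_antimono[of n "max m n" t] by auto
    then show ?thesis
      by (auto simp: piece_def)
  qed
  have "bdd_above (range (\<lambda>k. left_end k (address k t)))"
    by (rule bdd_aboveI2[OF le[of _ 0]])
  then show ?thesis
    unfolding piece_def cantor_point_def using le
    by (auto intro!: cSUP_least cSUP_upper)
qed

lemma cantor_point_in_cantor_set: "t < 1 \<Longrightarrow> cantor_point t \<in> cantor_set"
  using cantor_point_in_piece address_less by (fastforce simp: cantor_set_def stage_def)

text \<open>Take \<open>k\<close> as the last level on which the addresses agree. Then
  \<open>t\<close> and \<open>u\<close> share a dyadic interval of length \<open>1 / 2 ^ k\<close>,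
  while their Cantor points lie in different children of one piece, on either side of the removed
  gap.\<close>

lemma cantor_point_separated:
  assumes "0 \<le> t" "t < u" "u < 1"
  obtains k where "u - t \<le> 1 / 2 ^ k" "l k - 2 * l (Suc k) \<le> dist (cantor_point t) (cantor_point u)"
proof -
  \<comment> \<open>Points further apart than \<open>1 / 2 ^ n\<close> have different addresses on
    level \<open>n\<close>, so agreement cannot propagate from level 0 to all levels.\<close>
  obtain n where "1 / 2 ^ n < u - t"
    using real_arch_pow_inv[of "u - t" "1 / 2"] assms(2) by (auto simp: power_one_over)
  then have neq_n: "address n t \<noteq> address n u"
    using address_bounds[of t n] address_bounds[of u n] assms by (auto simp: add_divide_distrib)
  have eq_0: "address 0 t = address 0 u"
    using address_less[of t 0] address_less[of u 0] assms by simp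
  obtain k where k: "address k t = address k u" "address (Suc k) t \<noteq> address (Suc k) u"
  proof (rule ccontr)
    assume "\<not> thesis"
    then have step: "address k t = address k u \<Longrightarrow> address (Suc k) t = address (Suc k) u" for k
      using that by blast
    have "address k t = address k u" for k
      by (induction k) (use eq_0 step in auto)
    then show False
      using neq_n by blast
  qed
  show ?thesis
  proof
    show "u - t \<le> 1 / 2 ^ k"
      using address_bounds[of t k] address_bounds[of u k] assms k(1) by (simp add: add_divide_distrib)
    have div: "address (Suc k) t div 2 = address k t" "address (Suc k) u div 2 = address k t"
      using k(1) address_Suc_div_2 by auto
    then have "address (Suc k) t mod 2 \<noteq> address (Suc k) u mod 2"
      using k(2) by (metis div_mult_mod_eq)
    then consider "address (Suc k) t mod 2 = 0 \<and> address (Suc k) u mod 2 = 1"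
      | "address (Suc k) t mod 2 = 1 \<and> address (Suc k) u mod 2 = 0"
      by force
    then show "l k - 2 * l (Suc k) \<le> dist (cantor_point t) (cantor_point u)"
      using cantor_point_in_piece[of t "Suc k"] cantor_point_in_piece[of u "Suc k"] div
      by cases (auto simp: piece_def dist_real_def)
  qed
qed

end

section \<open>Self-similar Cantor sets for exponents below 1\<close>

lemma powr_mean_le:
  fixes a b s :: real
  assumes "0 < a" "0 < b" "0 < s" "s \<le> 1"
  shows "(a powr s + b powr s) / 2 \<le> ((a + b) / 2) powr s"
proof -
  \<comment> \<open>Concavity of the power \<open>s\<close> is obtained from convexity of its
    inverse, the power \<open>1 / s\<close> with exponent at least 1.\<close>
  have "((a powr s + b powr s) / 2) powr (1 / s) \<le> ((a powr s) powr (1 / s) + (b powr s) powr (1 / s)) / 2"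
    using convex_onD[OF powr_convex[of "1 / s"], of "1 / 2" "a powr s" "b powr s"] assms
    by (simp add: add_divide_distrib)
  also have "\<dots> = (a + b) / 2"
    using assms by (simp add: powr_powr)
  finally have "(((a powr s + b powr s) / 2) powr (1 / s)) powr s \<le> ((a + b) / 2) powr s"
    using assms by (intro powr_mono2) auto
  then show ?thesis
    using assms by (simp add: powr_powr)
qed

lemma power_powr_swap: "((x::real) ^ k) powr s = (x powr s) ^ k"
  by (induction k) (simp_all add: powr_mult)

locale self_similar_cantor =
  fixes s r :: real
  assumes s: "0 < s" "s < 1" and r: "0 < r" "r powr s = 1 / 2"
begin

lemma r_less_half: "r < 1 / 2"
proof (rule ccontr)
  assume "\<not> r < 1 / 2"
  then have "(1 / 2) powr s \<le> r powr s"
    using s by (intro powr_mono2) auto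
  moreover have "(1 / 2 :: real) powr 1 < (1 / 2) powr s"
    using s by (intro powr_less_mono') auto
  ultimately show False
    using r by simp
qed

sublocale cantor_lengths "\<lambda>k. r ^ k"
  using r(1) r_less_half by unfold_locales auto

text \<open>The recursion of \<open>left_end\<close> splits off the last digit, but the similarities
  of ratio \<open>r\<close> act on the first one. This lemma and the next one treat first digit 0
  and first digit 1.\<close>

lemma left_end_left_half: "i < 2 ^ k \<Longrightarrow> left_end (Suc k) i = r * left_end k i"
proof (induction k arbitrary: i)
  case (Suc k)
  then have "left_end (Suc k) (i div 2) = r * left_end k (i div 2)"
    by (intro Suc.IH) auto
  then show ?case
    by (subst (1 2) left_end.simps) (simp add: algebra_simps del: left_end.simps)
qed simp

lemma left_end_right_half: "i < 2 ^ k \<Longrightarrow> left_end (Suc k) (2 ^ k + i) = 1 - r + r * left_end k i"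
proof (induction k arbitrary: i)
  case (Suc k)
  then have "left_end (Suc k) (2 ^ k + i div 2) = 1 - r + r * left_end k (i div 2)"
    by (intro Suc.IH) auto
  moreover have "(2 ^ Suc k + i) div 2 = 2 ^ k + i div 2" "(2 ^ Suc k + i) mod 2 = i mod 2"
    by simp_all
  ultimately show ?case
    by (subst (1 2) left_end.simps) (simp only:, simp add: algebra_simps del: left_end.simps)
qed simp

lemma left_end_last: "left_end k (2 ^ k - Suc 0) = 1 - r ^ k"
proof (induction k)
  case (Suc k)
  have "(1::nat) \<le> 2 ^ k"
    by simp
  then have "(2 ^ Suc k - Suc 0) div 2 = 2 ^ k - Suc 0" "(2 ^ Suc k - Suc 0) mod 2 = 1"
    unfolding power_Suc by presburger+
  then show ?case
    using Suc by (simp only: left_end.simps) simp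
qed simp

lemma left_end_0: "left_end k 0 = 0"
  by (induction k) auto

text \<open>A discrete form of the Hoelder bound: it compares the hull of the dyadic intervals
  \<open>i\<close> to \<open>j\<close> with the hull of the corresponding pieces. Induction is on
  the first digit. If both indices lie in one half, scaling by \<open>r\<close> multiplies the power
  by \<open>r powr s = 1 / 2\<close>, matching the halved dyadic length; otherwise concavity is
  used. Monotonicity of the left ends is carried along to keep the bases of the powers
  nonnegative.\<close>

lemma left_end_holder:
  assumes "i \<le> j" "j < 2 ^ k"
  shows "left_end k i \<le> left_end k j \<and>
    (real j + 1 - real i) / 2 ^ k \<le> (left_end k j + r ^ k - left_end k i) powr s"
  using assms
proof (induction k arbitrary: i j)
  case (Suc k)
  have half: "(real j + 1 - real i) / 2 ^ Suc k \<le> (r * (left_end k j + r ^ k - left_end k i)) powr s"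
    if "i \<le> j" "j < 2 ^ k" for i j
  proof -
    have "0 \<le> left_end k j + r ^ k - left_end k i"
      using Suc.IH[OF that] zero_less_power[OF r(1), of k] by simp
    then have "(r * (left_end k j + r ^ k - left_end k i)) powr s
        = (left_end k j + r ^ k - left_end k i) powr s / 2"
      using r by (simp add: powr_mult)
    then show ?thesis
      using Suc.IH[OF that] by simp
  qed
  consider "j < 2 ^ k" | "2 ^ k \<le> i" | "i < 2 ^ k" "2 ^ k \<le> j"
    by linarith
  then show ?case
  proof cases
    case 1
    then have "i < 2 ^ k"
      using Suc.prems by simp
    then show ?thesis
      using 1 Suc.IH[of i j] Suc.prems half[of i j] r(1)
      by (simp add: left_end_left_half algebra_simps del: left_end.simps)
  next
    case 2
    define i' j' where "i' = i - 2 ^ k" and "j' = j - 2 ^ k"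
    have ij: "i = 2 ^ k + i'" "j = 2 ^ k + j'" "i' \<le> j'" "j' < 2 ^ k" "i' < 2 ^ k"
      using 2 Suc.prems by (auto simp: i'_def j'_def)
    have left_ends: "left_end (Suc k) i = 1 - r + r * left_end k i'"
        "left_end (Suc k) j = 1 - r + r * left_end k j'"
      using left_end_right_half[OF ij(5)] left_end_right_half[OF ij(4)] by (simp_all only: ij(1,2))
    have diff: "left_end (Suc k) j + r ^ Suc k - left_end (Suc k) i = r * (left_end k j' + r ^ k - left_end k i')"
      unfolding left_ends by (simp add: algebra_simps)
    have index: "real j + 1 - real i = real j' + 1 - real i'"
      by (simp add: ij(1,2))
    have "left_end (Suc k) i \<le> left_end (Suc k) j"
      unfolding left_ends using Suc.IH[OF ij(3,4)] r(1) by simp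
    then show ?thesis
      using half[OF ij(3,4)] unfolding diff index by blast
  next
    case 3
    define j' where "j' = j - 2 ^ k"
    have j: "j = 2 ^ k + j'" "j' < 2 ^ k"
      using 3 Suc.prems by (auto simp: j'_def)
    have left_ends: "left_end (Suc k) i = r * left_end k i"
        "left_end (Suc k) j = 1 - r + r * left_end k j'"
      using left_end_left_half[OF 3(1)] left_end_right_half[OF j(2)] by (simp_all only: j(1))
    \<comment> \<open>Rescaled by \<open>1 / r\<close>, these are the lengths of the parts of the
      hull in the left and in the right half. The whole hull has length \<open>r * a + r * b\<close>
      plus the gap \<open>1 - 2 * r\<close>.\<close>
    define a b where "a = 1 - left_end k i" and "b = left_end k j' + r ^ k"
    have last: "i \<le> 2 ^ k - 1" "j' \<le> 2 ^ k - 1"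
      using 3 j(2) by linarith+
    then have a: "r ^ k \<le> a" "(2 ^ k - real i) / 2 ^ k \<le> a powr s"
      using Suc.IH[of i "2 ^ k - 1"] by (simp_all add: left_end_last a_def of_nat_diff)
    have b: "r ^ k \<le> b" "(real j' + 1) / 2 ^ k \<le> b powr s"
      using Suc.IH[of 0 j'] j by (simp_all add: left_end_0 b_def)
    have le_1: "a \<le> 1" "b \<le> 1"
      using Suc.IH[of 0 i] Suc.IH[of j' "2 ^ k - 1"] 3 j last by (simp_all add: left_end_0 left_end_last a_def b_def)
    have pos: "0 < a" "0 < b"
      using a(1) b(1) zero_less_power[OF r(1), of k] by linarith+
    \<comment> \<open>As \<open>a\<close> and \<open>b\<close> are at most 1, the gap is large
      enough for the whole hull to be at least the mean of \<open>a\<close> and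
      \<open>b\<close>.\<close>
    have "(1 - 2 * r) * ((a + b) / 2) \<le> (1 - 2 * r) * 1"
      using r_less_half le_1 by (intro mult_left_mono) auto
    then have mean: "(a + b) / 2 \<le> 1 - 2 * r + r * (a + b)"
      by (simp add: field_simps)
    have "(real j + 1 - real i) / 2 ^ Suc k = ((2 ^ k - real i) / 2 ^ k + (real j' + 1) / 2 ^ k) / 2"
      by (simp add: j field_simps)
    also have "\<dots> \<le> (a powr s + b powr s) / 2"
      by (intro divide_right_mono add_mono a(2) b(2)) simp
    also have "\<dots> \<le> ((a + b) / 2) powr s"
      using pos s by (intro powr_mean_le) auto
    also have "\<dots> \<le> (1 - 2 * r + r * (a + b)) powr s"
      using mean pos s by (intro powr_mono2) auto
    also have "1 - 2 * r + r * (a + b) = left_end (Suc k) j + r ^ Suc k - left_end (Suc k) i"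
      unfolding left_ends by (simp add: a_def b_def algebra_simps)
    finally have "(real j + 1 - real i) / 2 ^ Suc k
        \<le> (left_end (Suc k) j + r ^ Suc k - left_end (Suc k) i) powr s" .
    moreover have "left_end (Suc k) i \<le> left_end (Suc k) j"
    proof -
      have "left_end k i \<le> 1" "0 \<le> left_end k j'"
        using a(1) b_def b(1) zero_less_power[OF r(1), of k] by (simp_all add: a_def)
      then have "r * left_end k i \<le> r * 1" "0 \<le> r * left_end k j'"
        using r(1) by (simp_all only: mult_left_mono less_imp_le mult_nonneg_nonneg)
      then show ?thesis
        unfolding left_ends using r_less_half by simp
    qed
    ultimately show ?thesis
      by blast
  qed
qed simp

text \<open>The discrete bound is applied to the pieces of level \<open>k\<close> containing the two
  points. Replacing the points by these pieces costs at most \<open>2 * r ^ k\<close> in length,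
  which vanishes in the limit.\<close>

lemma cantor_point_holder:
  assumes t: "0 \<le> t" "t < u" "u < 1"
  shows "u - t \<le> dist (cantor_point t) (cantor_point u) powr s"
proof -
  define d where "d = cantor_point u - cantor_point t"
  have *: "0 \<le> d + 2 * r ^ k \<and> u - t \<le> (d + 2 * r ^ k) powr s" for k
  proof -
    have "address k t \<le> address k u" "address k u < 2 ^ k"
      using t address_less by (auto simp: address_def intro!: nat_mono floor_mono)
    from left_end_holder[OF this] have
      L: "left_end k (address k t) \<le> left_end k (address k u)"
      "(real (address k u) + 1 - real (address k t)) / 2 ^ k
        \<le> (left_end k (address k u) + r ^ k - left_end k (address k t)) powr s"
      by auto
    have le: "left_end k (address k u) + r ^ k - left_end k (address k t) \<le> d + 2 * r ^ k"
      using cantor_point_in_piece[of t k] cantor_point_in_piece[of u k] by (simp add: piece_def d_def)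
    have "u - t \<le> (real (address k u) + 1 - real (address k t)) / 2 ^ k"
      using address_bounds[of t k] address_bounds[of u k] t by (simp add: diff_divide_distrib)
    also note L(2)
    also have "(left_end k (address k u) + r ^ k - left_end k (address k t)) powr s \<le> (d + 2 * r ^ k) powr s"
      using L(1) le zero_less_power[OF r(1), of k] s by (intro powr_mono2) linarith+
    finally show ?thesis
      using L(1) le zero_less_power[OF r(1), of k] by auto
  qed
  have "(\<lambda>k. r ^ k) \<longlonglongrightarrow> 0"
    using r(1) r_less_half by (intro LIMSEQ_realpow_zero) auto
  then have "(\<lambda>k. d + 2 * r ^ k) \<longlonglongrightarrow> d + 2 * 0"
    by (intro tendsto_add tendsto_mult tendsto_const)
  then have lim: "(\<lambda>k. d + 2 * r ^ k) \<longlonglongrightarrow> d"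
    by (simp only: mult_zero_right add_0_right)
  have "(\<lambda>k. (d + 2 * r ^ k) powr s) \<longlonglongrightarrow> d powr s"
    using * s by (intro tendsto_powr' lim tendsto_const) auto
  then have "u - t \<le> d powr s"
    using * by (intro LIMSEQ_le_const[where X = "\<lambda>k. (d + 2 * r ^ k) powr s"]) auto
  moreover have "0 \<le> d"
    using * by (intro LIMSEQ_le_const[OF lim]) auto
  ultimately show ?thesis
    by (simp add: d_def dist_real_def)
qed

lemma hausdorff_measure_eq_1: "hausdorff_measure s cantor_set = 1"
proof (rule antisym)
  have "(r ^ k) powr s = (1 / 2) ^ k" for k
    by (simp only: power_powr_swap r)
  then have "(\<lambda>k. 2 ^ k * (r ^ k) powr s) \<longlonglongrightarrow> 1"
    by (simp add: power_one_over)
  then show "hausdorff_measure s cantor_set \<le> 1"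
    using hausdorff_measure_cantor_set_le[OF s(1)] by fastforce
  show "1 \<le> hausdorff_measure s cantor_set"
    using hausdorff_measure_ge_if_holder_surj[of cantor_point cantor_set 1 s]
      cantor_point_in_cantor_set cantor_point_holder s by simp
qed

lemma summable_lengths: "summable (\<lambda>k. (real k + 1) * 2 ^ k * r ^ k)"
proof (rule summable_comparison_test_bigo)
  \<comment> \<open>Since \<open>2 * r = c * c\<close>, one factor \<open>c ^ k\<close> absorbs the
    linear weight and the other leaves a geometric series.\<close>
  define c where "c = sqrt (2 * r)"
  have c: "0 < c" "c < 1" and c2: "2 * r = c\<^sup>2"
    using r(1) r_less_half by (auto simp: c_def)
  show "summable (\<lambda>k. norm (c ^ k))"
    using c by (simp add: summable_geometric_iff)
  have "(\<lambda>k. (real k + 1) * (c ^ k * c ^ k)) \<in> O(\<lambda>k. c ^ k)"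
    using c by real_asymp
  then show "(\<lambda>k. (real k + 1) * 2 ^ k * r ^ k) \<in> O(\<lambda>k. c ^ k)"
    by (simp add: mult.assoc power_mult_distrib[symmetric] c2 power2_eq_square)
qed

end

section \<open>A Cantor set of dimension 1\<close>

text \<open>The cubic factor keeps the dimension equal to 1 while making \<open>\<Sum>k. (k + 1) * 2 ^ k * l k\<close>
  converge; a set of positive measure would not do, since the boundary values of a bounded
  holomorphic function cannot vanish on it.\<close>

definition thick_length :: "nat \<Rightarrow> real" where
  "thick_length k = 1 / (2 ^ k * (real k + 1) ^ 3)"

interpretation thick: cantor_lengths thick_length
proof
  fix k
  have "(real k + 1) ^ 3 < (real (Suc k) + 1) ^ 3"
    by (intro power_strict_mono) auto
  then show "2 * thick_length (Suc k) < thick_length k"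
    by (simp add: thick_length_def frac_less2 del: of_nat_Suc)
qed (auto simp: thick_length_def intro!: mult_pos_pos)

text \<open>With \<open>a\<close> and \<open>b\<close> the cubes of \<open>k + 1\<close> and
  \<open>k + 2\<close>, the gap is \<open>(1 / a - 1 / b) / 2 ^ k\<close>. Since
  \<open>b - a\<close> is at least 1 and \<open>a\<close> at most \<open>b\<close>, the difference
  of reciprocals is at least \<open>1 / (b * b)\<close>.\<close>

lemma thick_gap_ge:
  "1 / (2 ^ k * (real k + 2) ^ 6) \<le> thick_length k - 2 * thick_length (Suc k)"
proof -
  define a b :: real where "a = (real k + 1) ^ 3" and "b = (real k + 2) ^ 3"
  have a: "0 < a" "a + 1 \<le> b"
    by (auto simp: a_def b_def power3_eq_cube algebra_simps intro!: add_pos_nonneg)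
  have "1 / (b * b) \<le> 1 / (a * b)"
    using a by (intro divide_left_mono mult_right_mono) auto
  also have "\<dots> \<le> (b - a) / (a * b)"
    using a by (intro divide_right_mono) auto
  also have "\<dots> = 1 / a - 1 / b"
    using a by (simp add: field_simps)
  finally have "(1 / (b * b)) / 2 ^ k \<le> (1 / a - 1 / b) / 2 ^ k"
    by (intro divide_right_mono) auto
  moreover have "b * b = (real k + 2) ^ 6"
    by (simp add: b_def flip: power_add)
  ultimately show ?thesis
    by (simp add: thick_length_def a_def b_def diff_divide_distrib mult.commute add.commute)
qed

lemma summable_thick_length: "summable (\<lambda>k. (real k + 1) * 2 ^ k * thick_length k)"
proof (rule summable_comparison_test_bigo)
  show "summable (\<lambda>k. norm (1 / real k ^ 2))"
    using inverse_power_summable[of 2, where 'a = real] by (simp add: inverse_eq_divide)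
  have "(\<lambda>k. (real k + 1) / (real k + 1) ^ 3) \<in> O(\<lambda>k. 1 / real k ^ 2)"
    by real_asymp
  then show "(\<lambda>k. (real k + 1) * 2 ^ k * thick_length k) \<in> O(\<lambda>k. 1 / real k ^ 2)"
    by (simp add: thick_length_def)
qed

text \<open>The lengths satisfy \<open>2 ^ k * l k\<close> to 0, so the 1-dimensional measure
  vanishes. For exponents below 1 the gaps fall short of \<open>1 / 2 ^ k\<close> only by a
  polynomial factor, so a Hoelder bound with some constant \<open>C\<close> makes the measure
  positive.\<close>

lemma hausdorff_dim_thick: "hausdorff_dim thick.cantor_set = 1"
proof (rule antisym)
  have "(\<lambda>k. 2 ^ k * thick_length k powr 1) = (\<lambda>k. 1 / (real k + 1) ^ 3)"
    using thick.l_pos less_imp_le by (simp add: fun_eq_iff powr_one) (simp add: thick_length_def)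
  moreover have "(\<lambda>k. 1 / (real k + 1) ^ 3) \<longlonglongrightarrow> 0"
    by real_asymp
  ultimately have "hausdorff_measure 1 thick.cantor_set = 0"
    using thick.hausdorff_measure_cantor_set_le[of 1 0] by simp
  then show "hausdorff_dim thick.cantor_set \<le> 1"
    unfolding hausdorff_dim_def by (intro Inf_lower) (auto simp: one_ereal_def intro!: exI[of _ 1])
next
  have nonzero: "hausdorff_measure s thick.cantor_set \<noteq> 0" if s: "0 \<le> s" "s < 1" for s
  proof -
    \<comment> \<open>Chosen so that \<open>1 / 2 = c * (1 / 2) powr s\<close>; the spare decay
      \<open>c ^ k\<close> outweighs the sixth power lost in the gap bound.\<close>
    define c :: real where "c = (1 / 2) powr (1 - s)"
    have c: "0 < c" "c < 1"
      using s powr_less_mono'[of "1 / 2" 0 "1 - s"] by (auto simp: c_def)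
    have "(\<lambda>k. c ^ k * (real k + 2) ^ 6) \<longlonglongrightarrow> 0"
      using c by real_asymp
    then have "Bseq (\<lambda>k. c ^ k * (real k + 2) ^ 6)"
      by (intro convergent_imp_Bseq convergentI)
    then obtain C where C: "C > 0" "\<And>k. norm (c ^ k * (real k + 2) ^ 6) \<le> C"
      by (rule BseqE) blast
    have "u - t \<le> C * dist (thick.cantor_point t) (thick.cantor_point u) powr s"
      if "0 \<le> t" "t < u" "u < 1" for t u
    proof -
      from that obtain k where k: "u - t \<le> 1 / 2 ^ k"
        "thick_length k - 2 * thick_length (Suc k) \<le> dist (thick.cantor_point t) (thick.cantor_point u)"
        by (rule thick.cantor_point_separated)
      define g :: real where "g = 1 / (2 ^ k * (real k + 2) ^ 6)"
      have 1: "(real k + 2) ^ 6 \<ge> 1"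
        by (rule one_le_power) auto
      have "(1 / 2 :: real) = c * (1 / 2) powr s"
        by (simp add: c_def flip: powr_add)
      then have "(1 / 2 :: real) ^ k = (c * (1 / 2) powr s) ^ k"
        by (rule arg_cong)
      also have "\<dots> = c ^ k * ((1 / 2) ^ k) powr s"
        by (simp only: power_mult_distrib power_powr_swap)
      finally have "1 / 2 ^ k = c ^ k * (1 / 2 ^ k) powr s"
        by (simp only: power_one_over)
      \<comment> \<open>The sixth power has base at least 1 and \<open>s\<close> is at most 1, so it
        may leave the power \<open>s\<close> unreduced.\<close>
      also have "\<dots> \<le> c ^ k * ((real k + 2) ^ 6 * g powr s)"
      proof -
        have "(1 / 2 ^ k) powr s = ((real k + 2) ^ 6 * g) powr s"
          using 1 by (simp add: g_def)
        also have "\<dots> = ((real k + 2) ^ 6) powr s * g powr s"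
          by (rule powr_mult)
        also have "\<dots> \<le> ((real k + 2) ^ 6) powr 1 * g powr s"
          using 1 s by (intro mult_right_mono powr_mono) auto
        finally show ?thesis
          using 1 c(1) by (intro mult_left_mono) (auto simp: powr_one)
      qed
      also have "\<dots> \<le> C * g powr s"
        using C(2)[of k] c(1) by (simp add: mult.assoc[symmetric] mult_right_mono)
      also have "\<dots> \<le> C * dist (thick.cantor_point t) (thick.cantor_point u) powr s"
        using C(1) s thick_gap_ge[of k] k(2)
        by (intro mult_left_mono powr_mono2) (auto simp: g_def)
      finally show ?thesis
        using k(1) by simp
    qed
    then have "ennreal (1 / C) \<le> hausdorff_measure s thick.cantor_set"
      using thick.cantor_point_in_cantor_set C(1) s by (intro hausdorff_measure_ge_if_holder_surj[where X = thick.cantor_point]) auto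
    then show ?thesis
      using C(1) by auto
  qed
  show "1 \<le> hausdorff_dim thick.cantor_set"
    unfolding hausdorff_dim_def
  proof (rule Inf_greatest)
    fix x assume "x \<in> {ereal s | s. 0 \<le> s \<and> hausdorff_measure s thick.cantor_set = 0}"
    then show "1 \<le> x"
      using nonzero by (force simp: one_ereal_def)
  qed
qed

section \<open>Smooth extension of rapidly decaying functions\<close>

locale boundary_set =
  fixes K :: "complex set"
  assumes closed_K: "closed K" and nonempty_K: "K \<noteq> {}"
    and Re_K: "\<And>p. p \<in> K \<Longrightarrow> Re p = 0"
begin

text \<open>The cap at 1 keeps the square of the distance below the distance itself and makes bounds
  in terms of \<open>trunc_dist\<close> uniform on the half-plane.\<close>

definition trunc_dist :: "complex \<Rightarrow> real" where
  "trunc_dist z = min 1 (infdist z K)"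

text \<open>A radius quadratic in the distance lets the disc leave the half-plane so little that each
  pole term \<open>x / (w - p + x)\<close> loses at most \<open>x / 4\<close> of its real part, and yet costs only powers of
  the distance in Cauchy's estimates.\<close>

definition nbhd :: "complex \<Rightarrow> complex set" where
  "nbhd z = ball z ((trunc_dist z)\<^sup>2 / 16)"

lemma trunc_dist_le_1: "trunc_dist z \<le> 1"
  by (simp add: trunc_dist_def)

lemma trunc_dist_le_norm: "p \<in> K \<Longrightarrow> trunc_dist z \<le> norm (z - p)"
  using infdist_le[of p K z] by (simp add: trunc_dist_def dist_norm)

lemma trunc_dist_nonneg: "trunc_dist z \<ge> 0"
  by (simp add: trunc_dist_def infdist_nonneg)

lemma trunc_dist_eq_0: "p \<in> K \<Longrightarrow> trunc_dist p = 0"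
  by (simp add: trunc_dist_def)

lemma continuous_on_trunc_dist: "continuous_on A trunc_dist"
  unfolding trunc_dist_def by (intro continuous_intros)

lemma trunc_dist_pos:
  assumes "z \<in> right_half_plane"
  shows "trunc_dist z > 0"
proof -
  have "z \<notin> K"
    using assms Re_K by (auto simp: right_half_plane_def)
  then show ?thesis
    using closed_K nonempty_K infdist_nonneg[of z K] in_closed_iff_infdist_zero[of K z]
    by (auto simp: trunc_dist_def)
qed

lemma open_right_half_plane: "open right_half_plane"
  unfolding right_half_plane_def by (rule open_halfspace_Re_gt)

lemma closure_right_half_plane: "closure right_half_plane = {z. Re z \<ge> 0}"
  using closure_halfspace_gt[of "1::complex" 0] by (simp add: right_half_plane_def inner_complex_def)

lemma frontier_right_half_plane: "frontier right_half_plane = {z. Re z = 0}"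
  unfolding frontier_def closure_right_half_plane interior_open[OF open_right_half_plane]
  by (auto simp: right_half_plane_def)

lemma convex_right_half_plane: "convex right_half_plane"
  unfolding right_half_plane_def by (rule convex_halfspace_Re_gt)

lemma center_in_nbhd: "z \<in> right_half_plane \<Longrightarrow> z \<in> nbhd z"
  using trunc_dist_pos[of z] by (simp add: nbhd_def)

text \<open>As \<open>p\<close> is imaginary, adding \<open>x\<close> moves \<open>z - p\<close>
  away from 0, so \<open>z\<close> is at least \<open>trunc_dist z\<close> away from the pole
  \<open>p - x\<close>. Passing from \<open>z\<close> to \<open>w\<close> loses at most a sixteenth
  of this.\<close>

lemma norm_nbhd:
  assumes "z \<in> right_half_plane" "w \<in> nbhd z" "p \<in> K" "x > 0"
  shows "norm (w - p + of_real x) \<ge> trunc_dist z / 2"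
proof -
  have "norm (z - p) \<le> norm (z - p + of_real x)"
    using assms(1) Re_K[OF assms(3)] assms(4)
    by (auto simp: norm_complex_def right_half_plane_def intro!: power_mono)
  moreover have "norm (w - z) \<le> (trunc_dist z)\<^sup>2 / 16"
    using assms(2) by (simp add: nbhd_def dist_norm norm_minus_commute)
  moreover have "(trunc_dist z)\<^sup>2 \<le> trunc_dist z"
    using trunc_dist_le_1[of z] trunc_dist_nonneg[of z] by (simp add: power2_eq_square mult_left_le)
  moreover have "norm (z - p + of_real x) \<le> norm (w - p + of_real x) + norm (w - z)"
    using norm_triangle_ineq4[of "w - p + of_real x" "w - z"] by (simp add: algebra_simps)
  ultimately show ?thesis
    using trunc_dist_le_norm[OF assms(3), of z] trunc_dist_nonneg[of z] by linarith
qed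

lemma Re_nbhd:
  assumes "z \<in> right_half_plane" "w \<in> nbhd z" "p \<in> K"
  shows "Re (w - p) \<ge> - ((trunc_dist z)\<^sup>2 / 16)"
proof -
  have "norm (w - z) \<le> (trunc_dist z)\<^sup>2 / 16"
    using assms(2) by (simp add: nbhd_def dist_norm norm_minus_commute)
  then have "\<bar>Re (w - z)\<bar> \<le> (trunc_dist z)\<^sup>2 / 16"
    using abs_Re_le_cmod order_trans by blast
  then show ?thesis
    using assms(1) Re_K[OF assms(3)] unfolding right_half_plane_def abs_le_iff by simp
qed

text \<open>For \<open>v = w - p + x\<close> the real part of \<open>x / v\<close> is
  \<open>x * Re v / (norm v)\<^sup>2\<close>. The disc radius bounds \<open>Re v\<close> below by
  minus a sixteenth of the squared distance, and \<open>(norm v)\<^sup>2\<close> is at least a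
  quarter of it.\<close>

lemma Re_pole_term_ge:
  assumes "z \<in> right_half_plane" "w \<in> nbhd z" "p \<in> K" "x > 0"
  shows "Re (of_real x / (w - p + of_real x)) \<ge> - x / 4"
proof -
  define v where "v = w - p + of_real x"
  have v: "norm v \<ge> trunc_dist z / 2" "Re v \<ge> - ((trunc_dist z)\<^sup>2 / 16)"
    using norm_nbhd[OF assms] Re_nbhd[OF assms(1-3)] assms(4) by (simp_all add: v_def)
  have "(trunc_dist z)\<^sup>2 / 4 \<le> (norm v)\<^sup>2"
    using power_mono[OF v(1), of 2] trunc_dist_nonneg[of z] by (simp add: power_divide)
  then have "- ((norm v)\<^sup>2 / 4) \<le> Re v"
    using v(2) by simp
  moreover have "(norm v)\<^sup>2 > 0"
    using v(1) trunc_dist_pos[OF assms(1)] by auto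
  ultimately have "- 1 / 4 \<le> Re v / (norm v)\<^sup>2"
    by (simp add: pos_le_divide_eq)
  then have "x * (- 1 / 4) \<le> x * (Re v / (norm v)\<^sup>2)"
    using assms(4) by (intro mult_left_mono) auto
  moreover have "Re (of_real x / v) = x * (Re v / (norm v)\<^sup>2)"
    by (simp add: Re_divide' Re_complex_div_gt_0 cmod_power2 Re_divide)
  ultimately show ?thesis
    by (simp add: v_def)
qed

text \<open>Here \<open>x\<close> dominates the distance, so \<open>Re v\<close> is at least
  \<open>x / 2\<close> and \<open>norm v\<close> at most \<open>4 * x\<close>; the bound is
  \<open>x * (x / 2) / (16 * x\<^sup>2)\<close>.\<close>

lemma Re_near_pole_term_ge:
  assumes "z \<in> right_half_plane" "w \<in> nbhd z" "p \<in> K" "trunc_dist z \<le> x" "norm (z - p) \<le> 2 * x"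
  shows "Re (of_real x / (w - p + of_real x)) \<ge> 1 / 32"
proof -
  define v where "v = w - p + of_real x"
  have x: "x > 0"
    using trunc_dist_pos[OF assms(1)] assms(4) by linarith
  have sq: "(trunc_dist z)\<^sup>2 \<le> trunc_dist z"
    using trunc_dist_le_1[of z] trunc_dist_nonneg[of z] by (simp add: power2_eq_square mult_left_le)
  have 1: "Re v \<ge> x / 2"
    using Re_nbhd[OF assms(1-3)] assms(4) x sq by (simp add: v_def)
  have "norm (w - z) \<le> x"
    using assms(2,4) sq x trunc_dist_nonneg[of z] by (simp add: nbhd_def dist_norm norm_minus_commute)
  then have "norm v \<le> 4 * x"
    using norm_triangle_ineq[of "w - z" "z - p + of_real x"] norm_triangle_ineq[of "z - p" "of_real x"]
      assms(5) x by (simp add: v_def algebra_simps)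
  then have 2: "(norm v)\<^sup>2 \<le> 16 * x\<^sup>2"
    using power_mono[of "norm v" "4 * x" 2] by (simp add: power_mult_distrib)
  have v: "(norm v)\<^sup>2 > 0"
    using 1 x by auto
  have "1 / 32 = x * (x / 2) / (16 * x\<^sup>2)"
    using x by (simp add: power2_eq_square)
  also have "\<dots> \<le> x * (x / 2) / (norm v)\<^sup>2"
    using 2 v x by (intro divide_left_mono) auto
  also have "\<dots> \<le> x * Re v / (norm v)\<^sup>2"
    using 1 x by (intro divide_right_mono mult_left_mono) auto
  also have "\<dots> = Re (of_real x / v)"
    by (simp add: cmod_power2 Re_divide)
  finally show ?thesis
    by (simp add: v_def)
qed

text \<open>The factor is \<open>(w - p - x) / (w - p + x)\<close>, the half-plane Blaschke factor
  with zero \<open>p + x\<close>. Its modulus is at most 1 in the half-plane. Outside, the squared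
  norms of numerator and denominator differ by \<open>4 * x * Re (w - p)\<close>, which the disc
  radius controls.\<close>

lemma norm_Blaschke_factor_le:
  assumes "z \<in> right_half_plane" "w \<in> nbhd z" "p \<in> K" "x > 0"
  shows "norm (1 - 2 * of_real x / (w - p + of_real x)) \<le> 1 + x"
proof -
  define v where "v = w - p + of_real x"
  have v: "norm v \<ge> trunc_dist z / 2" "Re (w - p) \<ge> - ((trunc_dist z)\<^sup>2 / 16)"
    using norm_nbhd[OF assms] Re_nbhd[OF assms(1-3)] by (simp_all add: v_def)
  have pos: "norm v > 0"
    using v(1) trunc_dist_pos[OF assms(1)] by auto
  have "(trunc_dist z)\<^sup>2 / 4 \<le> (norm v)\<^sup>2"
    using power_mono[OF v(1), of 2] trunc_dist_nonneg[of z] by (simp add: power_divide)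
  then have "- (Re (w - p)) \<le> (norm v)\<^sup>2 / 4"
    using v(2) by simp
  then have "x * (- Re (w - p)) \<le> x * ((norm v)\<^sup>2 / 4)"
    using assms(4) by (intro mult_left_mono) auto
  moreover have Rev: "Re (w - p) = Re v - x"
    by (simp add: v_def)
  have "(norm (v - 2 * of_real x))\<^sup>2 = (norm v)\<^sup>2 - 4 * x * Re (w - p)"
    unfolding Rev cmod_power2 by (simp add: power2_eq_square algebra_simps)
  ultimately have "(norm (v - 2 * of_real x))\<^sup>2 \<le> (norm v)\<^sup>2 * (1 + x)"
    by (simp add: algebra_simps)
  also have "\<dots> \<le> (norm v)\<^sup>2 * (1 + x)\<^sup>2"
    using assms(4) by (intro mult_left_mono self_le_power) auto
  finally have "(norm (v - 2 * of_real x))\<^sup>2 \<le> (norm v * (1 + x))\<^sup>2"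
    by (simp only: power_mult_distrib)
  then have "norm (v - 2 * of_real x) \<le> norm v * (1 + x)"
    by (rule power2_le_imp_le) (use assms(4) in simp)
  moreover have "1 - 2 * of_real x / v = (v - 2 * of_real x) / v"
    using pos by (auto simp: field_simps)
  ultimately show ?thesis
    using pos by (simp add: v_def[symmetric] norm_divide divide_le_eq mult.commute)
qed

section \<open>Cauchy estimates and extension to the closed half-plane\<close>

lemma holomorphic_on_right_half_planeI:
  assumes "\<And>z. z \<in> right_half_plane \<Longrightarrow> f holomorphic_on nbhd z"
  shows "f holomorphic_on right_half_plane"
  unfolding holomorphic_on_def
proof
  fix z assume z: "z \<in> right_half_plane"
  have "f field_differentiable at z"
    using assms[OF z] center_in_nbhd[OF z] holomorphic_on_imp_differentiable_at
    unfolding nbhd_def by blast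
  then show "f field_differentiable at z within right_half_plane"
    by (rule field_differentiable_at_within)
qed

text \<open>Cauchy's inequality bounds every derivative by a multiple of the distance. Boundedness
  of the next derivative makes each one Lipschitz on the convex half-plane, hence uniformly
  continuous and extendable; the distance bound passes to the closure and forces zeros on
  \<open>K\<close>.\<close>

lemma smooth_extension_if_rapidly_decaying:
  assumes hol: "\<And>z. z \<in> right_half_plane \<Longrightarrow> f holomorphic_on nbhd z"
    and decay: "\<And>n. \<exists>C. \<forall>z\<in>right_half_plane. \<forall>w\<in>nbhd z. norm (f w) \<le> C * trunc_dist z ^ n"
  shows "\<exists>h. smooth_extension f h \<and> (\<forall>n. \<forall>p\<in>K. h n p = 0)"
proof -
  have fhol: "f holomorphic_on right_half_plane"
    using hol by (rule holomorphic_on_right_half_planeI)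
  have deriv_bound: "\<exists>C. \<forall>z\<in>right_half_plane. norm ((deriv ^^ n) f z) \<le> C * trunc_dist z" for n
  proof -
    \<comment> \<open>The \<open>n\<close>-th derivative costs \<open>n\<close> divisions by a
      radius quadratic in the distance; order \<open>2 * n + 1\<close> leaves one factor of the
      distance.\<close>
    obtain C where C: "\<And>z w. z \<in> right_half_plane \<Longrightarrow> w \<in> nbhd z \<Longrightarrow> norm (f w) \<le> C * trunc_dist z ^ (2 * n + 1)"
      using decay[of "2 * n + 1"] by blast
    have "norm ((deriv ^^ n) f z) \<le> fact n * C * 32 ^ n * trunc_dist z" if z: "z \<in> right_half_plane" for z
    proof -
      define r where "r = (trunc_dist z)\<^sup>2 / 32"
      have r: "r > 0"
        using trunc_dist_pos[OF z] by (simp add: r_def)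
      have sub: "cball z r \<subseteq> nbhd z"
        using r by (simp add: nbhd_def r_def cball_subset_ball_iff)
      have holr: "f holomorphic_on cball z r"
        using hol[OF z] sub by (rule holomorphic_on_subset)
      have "norm ((deriv ^^ n) f z) \<le> fact n * (C * trunc_dist z ^ (2 * n + 1)) / r ^ n"
      proof (rule Cauchy_inequality)
        show "f holomorphic_on ball z r"
          using holr by (rule holomorphic_on_subset) auto
        show "continuous_on (cball z r) f"
          using holr by (rule holomorphic_on_imp_continuous_on)
        show "norm (f x) \<le> C * trunc_dist z ^ (2 * n + 1)" if "norm (z - x) = r" for x
          using that sub by (intro C[OF z]) (auto simp: dist_norm)
      qed (rule r)
      also have "\<dots> = fact n * C * 32 ^ n * trunc_dist z"
        using trunc_dist_pos[OF z] by (simp add: r_def power_divide power_mult)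
      finally show ?thesis .
    qed
    then show ?thesis by blast
  qed
  have "\<exists>g. continuous_on (closure right_half_plane) g \<and>
      (\<forall>z\<in>right_half_plane. g z = (deriv ^^ n) f z) \<and> (\<forall>p\<in>K. g p = 0)" for n
  proof -
    obtain C where C: "\<And>z. z \<in> right_half_plane \<Longrightarrow> norm ((deriv ^^ n) f z) \<le> C * trunc_dist z"
      using deriv_bound by blast
    obtain D where D: "\<And>z. z \<in> right_half_plane \<Longrightarrow> norm ((deriv ^^ Suc n) f z) \<le> D * trunc_dist z"
      using deriv_bound by blast
    have lip: "\<bar>D\<bar>-lipschitz_on right_half_plane ((deriv ^^ n) f)"
    proof (rule lipschitz_onI)
      fix x y assume xy: "x \<in> right_half_plane" "y \<in> right_half_plane"
      show "dist ((deriv ^^ n) f x) ((deriv ^^ n) f y) \<le> \<bar>D\<bar> * dist x y"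
        unfolding dist_norm
      proof (rule field_differentiable_bound[OF convex_right_half_plane _ _ xy])
        fix z assume z: "z \<in> right_half_plane"
        have "(deriv ^^ n) f holomorphic_on right_half_plane"
          by (intro holomorphic_higher_deriv fhol open_right_half_plane)
        then have "((deriv ^^ n) f has_field_derivative deriv ((deriv ^^ n) f) z) (at z)"
          using z open_right_half_plane holomorphic_derivI by blast
        then show "((deriv ^^ n) f has_field_derivative (deriv ^^ Suc n) f z) (at z within right_half_plane)"
          by (auto intro: has_field_derivative_at_within)
        have "D * trunc_dist z \<le> \<bar>D\<bar> * 1"
          using trunc_dist_le_1[of z] trunc_dist_nonneg[of z] by (intro mult_mono) auto
        then show "norm ((deriv ^^ Suc n) f z) \<le> \<bar>D\<bar>"
          using D[OF z] by simp
      qed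
    qed simp
    obtain g where g: "uniformly_continuous_on (closure right_half_plane) g"
        "\<And>z. z \<in> right_half_plane \<Longrightarrow> (deriv ^^ n) f z = g z"
      using uniformly_continuous_on_extension_on_closure[OF lipschitz_on_uniformly_continuous[OF lip]]
      by metis
    have cont: "continuous_on (closure right_half_plane) g"
      using g(1) by (rule uniformly_continuous_imp_continuous)
    have le: "norm (g z) \<le> C * trunc_dist z" if "z \<in> closure right_half_plane" for z
      using C g(2)
      by (intro continuous_le_on_closure[OF _ that, where f = "\<lambda>z. norm (g z) - C * trunc_dist z" and a = 0, simplified]
            continuous_intros continuous_on_trunc_dist cont) auto
    have "g p = 0" if "p \<in> K" for p
      using le[of p] Re_K[OF that] trunc_dist_eq_0[OF that] by (simp add: closure_right_half_plane)
    then show ?thesis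
      using cont g(2) by (intro exI[of _ g]) auto
  qed
  then obtain h where "\<And>n. continuous_on (closure right_half_plane) (h n) \<and>
      (\<forall>z\<in>right_half_plane. h n z = (deriv ^^ n) f z) \<and> (\<forall>p\<in>K. h n p = 0)"
    by metis
  then show ?thesis
    using fhol unfolding smooth_extension_def by blast
qed

end

section \<open>Functions with prescribed boundary behaviour\<close>

lemma prod_one_plus_le_exp:
  fixes x :: "nat \<Rightarrow> real"
  assumes "\<And>j. 0 \<le> x j" "summable x"
  shows "(\<Prod>j<n. 1 + x j) \<le> exp (suminf x)"
proof -
  have "(\<Prod>j<n. 1 + x j) \<le> (\<Prod>j<n. exp (x j))"
    using assms(1) by (intro prod_mono) (auto simp: add_nonneg_nonneg exp_ge_add_one_self)
  also have "\<dots> = exp (\<Sum>j<n. x j)"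
    by (simp add: exp_sum)
  also have "\<dots> \<le> exp (suminf x)"
    using assms by (simp add: sum_le_suminf)
  finally show ?thesis .
qed

text \<open>The index encodes a pair whose first component selects a member of a countable dense
  subset, while the second makes it recur arbitrarily late. Late recurrence is needed because the
  zeros \<open>q j + x j\<close> are close to \<open>q j\<close> only for large
  \<open>j\<close>.\<close>

lemma recurrent_dense_sequence:
  fixes K :: "'a::{metric_space, second_countable_topology} set"
  assumes "K \<noteq> {}"
  obtains q :: "nat \<Rightarrow> 'a" where "\<And>n. q n \<in> K"
    and "\<And>p (e::real) N. p \<in> K \<Longrightarrow> e > 0 \<Longrightarrow> \<exists>n\<ge>N. dist (q n) p < e"
proof -
  obtain T where T: "countable T" "T \<subseteq> K" "K \<subseteq> closure T"
    using separable by blast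
  have ne: "T \<noteq> {}"
    using T(3) assms by auto
  define q where "q n = from_nat_into T (fst (prod_decode n))" for n
  have qT: "q n \<in> T" for n
    unfolding q_def by (rule from_nat_into[OF ne])
  show ?thesis
  proof
    show "q n \<in> K" for n
      using qT T(2) by blast
    fix p and e :: real and N :: nat
    assume "p \<in> K" "e > 0"
    then obtain t where t: "t \<in> T" "dist t p < e"
      using T(3) closure_approachable[of p T] by blast
    then have "q (prod_encode (to_nat_on T t, N)) = t"
      using T(1) by (simp add: q_def)
    then show "\<exists>n\<ge>N. dist (q n) p < e"
      using t(2) le_prod_encode_2[of N "to_nat_on T t"] by metis
  qed
qed

context boundary_set
begin

text \<open>The zeros are \<open>q j + x j\<close> with \<open>x j\<close> summable and
  \<open>q\<close> recurrent in \<open>K\<close>. Summability gives locally uniform convergence on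
  each disc, and the factors, bounded by \<open>1 + x j\<close>, give a bound uniform over all
  discs.\<close>

lemma ex_Blaschke_product:
  obtains G B where
    "\<And>z. z \<in> right_half_plane \<Longrightarrow> G holomorphic_on nbhd z"
    "\<And>z w. z \<in> right_half_plane \<Longrightarrow> w \<in> nbhd z \<Longrightarrow> norm (G w) \<le> B"
    "\<exists>z\<in>right_half_plane. G z \<noteq> 0"
    "\<And>p. p \<in> K \<Longrightarrow> \<exists>w. (\<forall>k. w k \<in> right_half_plane \<and> G (w k) = (0::complex)) \<and> w \<longlonglongrightarrow> p"
proof -
  obtain q :: "nat \<Rightarrow> complex" where qK: "\<And>j. q j \<in> K"
    and q_dense: "\<And>p (e::real) N. p \<in> K \<Longrightarrow> e > 0 \<Longrightarrow> \<exists>j\<ge>N. dist (q j) p < e"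
    using recurrent_dense_sequence[OF nonempty_K] by blast
  define x where "x j = (1 / 2 :: real) ^ j" for j
  have x_pos: "x j > 0" for j
    by (simp add: x_def)
  have x_sum: "summable x"
    unfolding x_def by (rule summable_geometric) simp
  \<comment> \<open>So \<open>1 + u j w\<close> is the Blaschke factor
    \<open>(w - q j - x j) / (w - q j + x j)\<close>.\<close>
  define u where "u j w = - (2 * of_real (x j) / (w - q j + of_real (x j)))" for j w
  define G where "G w = (\<Prod>j. 1 + u j w)" for w
  have u_norm: "norm (u j w) \<le> x j * (4 / trunc_dist z)"
    if "z \<in> right_half_plane" "w \<in> nbhd z" for j z w
  proof -
    have "norm (u j w) = 2 * x j / norm (w - q j + of_real (x j))"
      using x_pos[of j] by (simp add: u_def norm_divide norm_mult)
    also have "\<dots> \<le> 2 * x j / (trunc_dist z / 2)"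
      using norm_nbhd[OF that qK[of j] x_pos[of j]] x_pos[of j] trunc_dist_pos[OF that(1)]
      by (intro divide_left_mono) (auto intro!: mult_pos_pos)
    finally show ?thesis by (simp add: mult.commute)
  qed
  have denom: "w - q j + of_real (x j) \<noteq> 0" if "z \<in> right_half_plane" "w \<in> nbhd z" for j z w
    using norm_nbhd[OF that qK[of j] x_pos[of j]] trunc_dist_pos[OF that(1)] by auto
  have u_hol: "u j holomorphic_on nbhd z" if "z \<in> right_half_plane" for j z
    unfolding u_def using denom[OF that] by (intro holomorphic_intros) auto
  have conv: "convergent_prod (\<lambda>j. 1 + u j w)" if "z \<in> right_half_plane" "w \<in> nbhd z" for z w
  proof (intro abs_convergent_prod_imp_convergent_prod summable_imp_abs_convergent_prod)
    have "summable (\<lambda>j. x j * (4 / trunc_dist z))"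
      by (intro summable_mult2 x_sum)
    then show "summable (\<lambda>j. norm (1 + u j w - 1))"
      by (rule summable_comparison_test'[where N = 0]) (use u_norm[OF that] in auto)
  qed
  have lim: "(\<lambda>n. \<Prod>j<n. 1 + u j w) \<longlonglongrightarrow> G w" if "z \<in> right_half_plane" "w \<in> nbhd z" for z w
    using convergent_prod_LIMSEQ[OF conv[OF that]] unfolding G_def
    by (subst (asm) LIMSEQ_lessThan_iff_atMost[symmetric]) auto
  show ?thesis
  proof
    fix z assume z: "z \<in> right_half_plane"
    show "G holomorphic_on nbhd z"
    proof (rule holomorphic_uniform_sequence)
      show "open (nbhd z)"
        by (simp add: nbhd_def)
      show "(\<lambda>w. \<Prod>j<n. 1 + u j w) holomorphic_on nbhd z" for n
        by (intro holomorphic_intros u_hol z)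
      fix v assume "v \<in> nbhd z"
      then obtain d where d: "d > 0" "cball v d \<subseteq> nbhd z"
        unfolding nbhd_def by (meson open_ball open_contains_cball)
      have "uniformly_convergent_on (cball v d) (\<lambda>n w. \<Prod>j<n. 1 + u j w)"
      proof (rule uniformly_convergent_on_prod)
        show "continuous_on (cball v d) (u j)" for j
          using u_hol[OF z] d(2) holomorphic_on_imp_continuous_on continuous_on_subset by metis
        show "uniformly_convergent_on (cball v d) (\<lambda>n w. \<Sum>j<n. norm (u j w))"
        proof (rule Weierstrass_m_test')
          show "norm (norm (u j w)) \<le> x j * (4 / trunc_dist z)" if "w \<in> cball v d" for j w
            using u_norm[OF z] that d(2) by auto
          show "summable (\<lambda>j. x j * (4 / trunc_dist z))"
            by (intro summable_mult2 x_sum)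
        qed
      qed simp
      then obtain g where g: "uniform_limit (cball v d) (\<lambda>n w. \<Prod>j<n. 1 + u j w) g sequentially"
        unfolding uniformly_convergent_on_def by blast
      have "g w = G w" if "w \<in> cball v d" for w
        using tendsto_uniform_limitI[OF g that] lim[OF z] that d(2) LIMSEQ_unique by blast
      then have "uniform_limit (cball v d) (\<lambda>n w. \<Prod>j<n. 1 + u j w) G sequentially"
        using g by (subst (asm) uniform_limit_cong'[where g = "\<lambda>n w. \<Prod>j<n. 1 + u j w" and i = G]) auto
      then show "\<exists>d>0. cball v d \<subseteq> nbhd z \<and>
          uniform_limit (cball v d) (\<lambda>n w. \<Prod>j<n. 1 + u j w) G sequentially"
        using d by blast
    qed
    show "norm (G w) \<le> exp (suminf x)" if w: "w \<in> nbhd z" for w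
    proof (rule LIMSEQ_le_const2[OF tendsto_norm[OF lim[OF z w]]])
      have "norm (\<Prod>j<n. 1 + u j w) \<le> exp (suminf x)" for n
      proof -
        have "norm (\<Prod>j<n. 1 + u j w) \<le> (\<Prod>j<n. 1 + x j)"
          unfolding prod_norm[symmetric]
          using norm_Blaschke_factor_le[OF z w qK x_pos] by (intro prod_mono) (auto simp: u_def)
        also have "\<dots> \<le> exp (suminf x)"
          using x_pos x_sum less_imp_le by (intro prod_one_plus_le_exp) blast+
        finally show ?thesis .
      qed
      then show "\<exists>N. \<forall>n\<ge>N. norm (\<Prod>j<n. 1 + u j w) \<le> exp (suminf x)"
        by blast
    qed
  next
    \<comment> \<open>All zeros have real part at most 1, so no factor vanishes at 2.\<close>
    have 2: "2 \<in> right_half_plane"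
      by (simp add: right_half_plane_def)
    have "1 + u j 2 \<noteq> 0" for j
    proof -
      have "1 + u j 2 = (2 - q j - of_real (x j)) / (2 - q j + of_real (x j))"
        using denom[OF 2 center_in_nbhd[OF 2], of j] by (simp add: u_def field_simps)
      moreover have "x j \<le> 1"
        unfolding x_def by (rule power_le_one) auto
      then have "Re (2 - q j - of_real (x j)) > 0"
        using Re_K[OF qK] by simp
      then have "2 - q j - of_real (x j) \<noteq> 0"
        by force
      ultimately show ?thesis
        using denom[OF 2 center_in_nbhd[OF 2], of j] by simp
    qed
    then have "G 2 \<noteq> 0"
      unfolding G_def by (intro prodinf_nonzero conv[OF 2 center_in_nbhd[OF 2]]) auto
    then show "\<exists>z\<in>right_half_plane. G z \<noteq> 0"
      using 2 by blast
  next
    fix p assume p: "p \<in> K"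
    \<comment> \<open>The index bound makes the shift \<open>x j\<close> at most \<open>x k\<close>
      as well, so the zero lies within \<open>2 * x k\<close> of \<open>p\<close>.\<close>
    have "\<exists>j\<ge>k. dist (q j) p < x k" for k
      using q_dense[OF p x_pos] .
    then obtain m where m: "\<And>k. m k \<ge> k" "\<And>k. dist (q (m k)) p < x k"
      by metis
    define w where "w k = q (m k) + of_real (x (m k))" for k
    have w: "w k \<in> right_half_plane" for k
      using x_pos Re_K[OF qK] by (simp add: w_def right_half_plane_def)
    have "1 + u (m k) (w k) = 0" for k
      using x_pos[of "m k"] by (simp add: u_def w_def field_simps)
    \<comment> \<open>\<open>convergent_prod\<close> tolerates finitely many zero factors, and the
      product is 0 exactly when some factor is.\<close>
    then have "G (w k) = 0" for k
      using convergent_prod_has_prod[OF conv[OF w center_in_nbhd[OF w]], of k]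
        has_prod_eq_0_iff unfolding G_def by (metis rangeI)
    moreover have "w \<longlonglongrightarrow> p"
    proof (rule metric_tendsto_imp_tendsto)
      show "(\<lambda>k. 2 * x k) \<longlonglongrightarrow> 0"
        using tendsto_mult_right_zero[OF summable_LIMSEQ_zero[OF x_sum], of 2] .
      have "dist (w k) p \<le> dist (2 * x k) 0" for k
      proof -
        have "x (m k) \<le> x k"
          unfolding x_def using m(1) by (intro power_decreasing) auto
        then show ?thesis
          using m(2)[of k] dist_triangle[of "w k" p "q (m k)"] x_pos[of k] x_pos[of "m k"]
          by (simp add: w_def dist_norm)
      qed
      then show "\<forall>\<^sub>F k in sequentially. dist (w k) p \<le> dist (2 * x k) 0"
        by simp
    qed
    ultimately show "\<exists>w. (\<forall>k. w k \<in> right_half_plane \<and> G (w k) = 0) \<and> w \<longlonglongrightarrow> p"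
      using w by blast
  qed
qed

text \<open>The bound \<open>q ^ k \<le> l k\<close> provides at least on the order of
  \<open>ln (1 / d)\<close> levels with \<open>l k \<ge> d\<close>; the weight \<open>k + 1\<close>
  turns their number into a square. The summability of \<open>sum_l\<close> makes \<open>F\<close>
  converge and keeps the negative contributions above \<open>- S\<close>.\<close>

lemma ex_rapidly_decaying_exp:
  fixes l :: "nat \<Rightarrow> real" and p :: "nat \<Rightarrow> nat \<Rightarrow> complex"
  assumes pK: "\<And>k i. i < 2 ^ k \<Longrightarrow> p k i \<in> K"
    and net: "\<And>y k. y \<in> K \<Longrightarrow> \<exists>i<2 ^ k. dist y (p k i) \<le> l k"
    and q: "0 < q" "q < 1" "\<And>k. q ^ k \<le> l k"
    and sum_l: "summable (\<lambda>k. (real k + 1) * 2 ^ k * l k)"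
  obtains F where
    "\<And>z. z \<in> right_half_plane \<Longrightarrow> F holomorphic_on nbhd z"
    "\<And>n. \<exists>C. \<forall>z\<in>right_half_plane. \<forall>w\<in>nbhd z. norm (exp (- F w)) \<le> C * trunc_dist z ^ n"
proof -
  have l_pos: "l k > 0" for k
    using q(3)[of k] zero_less_power[OF q(1), of k] by linarith
  \<comment> \<open>At distance \<open>d\<close> from \<open>K\<close>, each level with \<open>l k \<ge> d\<close> has a pole close enough to contribute at
    least \<open>(k + 1) / 32\<close>, so \<open>Re F\<close> grows at least like \<open>ln\<^sup>2 d\<close> and \<open>exp (- F)\<close> beats every power of \<open>d\<close>.\<close>
  define T where "T k i w = of_real (l k) / (w - p k i + of_real (l k))" for k i w
  define H where "H k w = of_real (real k + 1) * (\<Sum>i<2 ^ k. T k i w)" for k w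
  define F where "F w = (\<Sum>k. H k w)" for w
  define S where "S = (\<Sum>k. (real k + 1) * 2 ^ k * l k)"
  have T_norm: "norm (T k i w) \<le> l k * (2 / trunc_dist z)"
    if "z \<in> right_half_plane" "w \<in> nbhd z" "i < 2 ^ k" for k i z w
  proof -
    have "norm (T k i w) = l k / norm (w - p k i + of_real (l k))"
      using l_pos[of k] by (simp add: T_def norm_divide)
    also have "\<dots> \<le> l k / (trunc_dist z / 2)"
      using norm_nbhd[OF that(1,2) pK[OF that(3)] l_pos[of k]] l_pos[of k] trunc_dist_pos[OF that(1)]
      by (intro divide_left_mono) (auto intro!: mult_pos_pos)
    finally show ?thesis by simp
  qed
  have H_norm: "norm (H k w) \<le> (real k + 1) * 2 ^ k * l k * (2 / trunc_dist z)"
    if "z \<in> right_half_plane" "w \<in> nbhd z" for k z w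
  proof -
    have "norm (\<Sum>i<2 ^ k. T k i w) \<le> (\<Sum>i<(2::nat) ^ k. l k * (2 / trunc_dist z))"
      by (intro sum_norm_le T_norm that) auto
    then have "(real k + 1) * norm (\<Sum>i<2 ^ k. T k i w) \<le> (real k + 1) * (2 ^ k * (l k * (2 / trunc_dist z)))"
      by (intro mult_left_mono) auto
    then show ?thesis
      by (simp add: H_def norm_mult mult.assoc del: of_real_add of_real_of_nat_eq)
  qed
  have sum_bound: "summable (\<lambda>k. (real k + 1) * 2 ^ k * l k * (2 / trunc_dist z))" for z
    by (intro summable_mult2 sum_l)
  have H_hol: "H k holomorphic_on nbhd z" if "z \<in> right_half_plane" for k z
  proof -
    have "w - p k i + of_real (l k) \<noteq> 0" if "w \<in> nbhd z" "i < 2 ^ k" for w i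
      using norm_nbhd[OF \<open>z \<in> _\<close> that(1) pK[OF that(2)] l_pos[of k]] trunc_dist_pos[OF \<open>z \<in> _\<close>] by auto
    then show ?thesis
      unfolding H_def T_def by (intro holomorphic_intros) auto
  qed
  have H_summable: "summable (\<lambda>k. H k w)" if "z \<in> right_half_plane" "w \<in> nbhd z" for z w
    using sum_bound by (rule summable_comparison_test'[where N = 0]) (use H_norm[OF that] in auto)
  have T_ge: "Re (T k i w) \<ge> - l k / 4"
    if "z \<in> right_half_plane" "w \<in> nbhd z" "i < 2 ^ k" for k i z w
    unfolding T_def using that by (intro Re_pole_term_ge pK l_pos)
  have const_sum: "(\<Sum>i<(2::nat) ^ k. - l k / 4) \<ge> - (2 ^ k * l k)" for k
  proof -
    have "(\<Sum>i<(2::nat) ^ k. - l k / 4) = - (2 ^ k * l k) / 4"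
      by simp
    moreover have "2 ^ k * l k \<ge> 0"
      using l_pos[of k] by simp
    ultimately show ?thesis
      by linarith
  qed
  have H_ge: "Re (H k w) \<ge> - ((real k + 1) * 2 ^ k * l k)"
    if "z \<in> right_half_plane" "w \<in> nbhd z" for k z w
  proof -
    have "(\<Sum>i<2 ^ k. Re (T k i w)) \<ge> (\<Sum>i<(2::nat) ^ k. - l k / 4)"
      by (intro sum_mono T_ge[OF that]) auto
    then have "(\<Sum>i<2 ^ k. Re (T k i w)) \<ge> - (2 ^ k * l k)"
      using const_sum[of k] by linarith
    then have "(real k + 1) * (\<Sum>i<2 ^ k. Re (T k i w)) \<ge> (real k + 1) * - (2 ^ k * l k)"
      by (intro mult_left_mono) auto
    then show ?thesis
      by (simp add: H_def Re_sum algebra_simps)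
  qed
  have H_ge_near: "Re (H k w) \<ge> - ((real k + 1) * 2 ^ k * l k) + (real k + 1) / 32"
    if z: "z \<in> right_half_plane" "w \<in> nbhd z" "trunc_dist z < 1" "trunc_dist z \<le> l k" for k z w
  proof -
    \<comment> \<open>Below 1 the truncation is inactive, so \<open>trunc_dist z\<close> is the
      distance to a nearest point \<open>y\<close>; a pole parameter within \<open>l k\<close> of
      \<open>y\<close> is within \<open>2 * l k\<close> of \<open>z\<close>.\<close>
    obtain y where y: "y \<in> K" "infdist z K = dist z y"
      using infdist_attains_inf[OF closed_K nonempty_K] by metis
    then have "norm (z - y) = trunc_dist z"
      using z(3) by (simp add: trunc_dist_def dist_norm split: if_splits)
    moreover obtain i where i: "i < 2 ^ k" "dist y (p k i) \<le> l k"
      using net[OF y(1)] by blast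
    ultimately have "norm (z - p k i) \<le> 2 * l k"
      using norm_triangle_ineq[of "z - y" "y - p k i"] z(4) by (simp add: dist_norm)
    then have "Re (T k i w) \<ge> 1 / 32"
      unfolding T_def using z pK i by (intro Re_near_pole_term_ge) auto
    moreover have "(\<Sum>j\<in>{..<2 ^ k} - {i}. Re (T k j w)) \<ge> (\<Sum>j\<in>{..<2 ^ k} - {i}. - l k / 4)"
      by (intro sum_mono T_ge[OF z(1,2)]) auto
    moreover have "(\<Sum>j\<in>{..<2 ^ k} - {i}. - l k / 4) \<ge> (\<Sum>j<(2::nat) ^ k. - l k / 4)"
      using l_pos[of k] i(1) by (subst sum.remove[of _ i]) auto
    moreover have "(\<Sum>j<2 ^ k. Re (T k j w)) = Re (T k i w) + (\<Sum>j\<in>{..<2 ^ k} - {i}. Re (T k j w))"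
      using i(1) by (intro sum.remove) auto
    moreover have "(\<Sum>j<(2::nat) ^ k. - l k / 4) \<ge> - (2 ^ k * l k)"
      by (rule const_sum)
    ultimately have "(\<Sum>j<2 ^ k. Re (T k j w)) \<ge> - (2 ^ k * l k) + 1 / 32"
      by linarith
    then have "(real k + 1) * (\<Sum>j<2 ^ k. Re (T k j w)) \<ge> (real k + 1) * (- (2 ^ k * l k) + 1 / 32)"
      by (intro mult_left_mono) auto
    then show ?thesis
      by (simp add: H_def Re_sum algebra_simps add_divide_distrib)
  qed
  \<comment> \<open>\<open>N\<close> collects levels with a near pole. The empty set gives the
    global lower bound \<open>- S\<close>.\<close>
  have F_ge: "Re (F w) \<ge> - S + (\<Sum>k\<in>N. (real k + 1) / 32)"
    if z: "z \<in> right_half_plane" "w \<in> nbhd z" and N: "finite N" "\<And>k. k \<in> N \<Longrightarrow> trunc_dist z < 1 \<and> trunc_dist z \<le> l k"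
    for N z w
  proof -
    define b where "b k = - ((real k + 1) * 2 ^ k * l k) + (if k \<in> N then (real k + 1) / 32 else 0)" for k
    have "(\<lambda>k. - ((real k + 1) * 2 ^ k * l k)) sums (- S)"
      unfolding S_def by (intro sums_minus summable_sums sum_l)
    moreover have "(\<lambda>k. if k \<in> N then (real k + 1) / 32 else 0) sums (\<Sum>k\<in>N. (real k + 1) / 32)"
      using N(1) by (rule sums_If_finite_set)
    ultimately have b: "b sums (- S + (\<Sum>k\<in>N. (real k + 1) / 32))"
      unfolding b_def by (rule sums_add)
    have ReF: "(\<lambda>k. Re (H k w)) sums Re (F w)"
      unfolding F_def by (intro sums_Re summable_sums H_summable[OF z])
    have le: "b k \<le> Re (H k w)" for k
      using H_ge[OF z, of k] H_ge_near[OF z, of k] N(2)[of k] by (auto simp: b_def)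
    show ?thesis
      by (rule sums_le[OF le b ReF])
  qed
  show ?thesis
  proof
    fix z assume z: "z \<in> right_half_plane"
    show "F holomorphic_on nbhd z"
    proof (rule holomorphic_uniform_sequence)
      show "open (nbhd z)"
        by (simp add: nbhd_def)
      show "(\<lambda>w. \<Sum>k<n. H k w) holomorphic_on nbhd z" for n
        by (intro holomorphic_intros H_hol z)
      have "uniform_limit (nbhd z) (\<lambda>n w. \<Sum>k<n. H k w) F sequentially"
        unfolding F_def by (rule Weierstrass_m_test[OF _ sum_bound]) (use H_norm[OF z] in auto)
      then show "\<exists>d>0. cball v d \<subseteq> nbhd z \<and> uniform_limit (cball v d) (\<lambda>n w. \<Sum>k<n. H k w) F sequentially"
        if "v \<in> nbhd z" for v
        using that uniform_limit_on_subset unfolding nbhd_def by (meson open_ball open_contains_cball)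
    qed
  next
    fix n :: nat
    \<comment> \<open>With this \<open>b\<close>, \<open>exp (- m * b)\<close> equals
      \<open>(q ^ m) ^ n\<close>; the second factor of \<open>C\<close> pays for completing a square
      below.\<close>
    define b where "b = real n * ln (1 / q)"
    define C where "C = exp S * exp (16 * b\<^sup>2)"
    have "norm (exp (- F w)) \<le> C * trunc_dist z ^ n" if z: "z \<in> right_half_plane" "w \<in> nbhd z" for z w
    proof (cases "trunc_dist z < 1")
      case False
      then have "trunc_dist z = 1"
        using trunc_dist_le_1[of z] by simp
      moreover have "norm (exp (- F w)) \<le> exp S"
        using F_ge[OF z, of "{}"] by simp
      moreover have "exp S * 1 \<le> C"
        unfolding C_def by (intro mult_left_mono) auto
      ultimately show ?thesis
        by (simp del: norm_exp_eq_Re)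
    next
      case True
      obtain M where M: "q ^ M < trunc_dist z"
        using real_arch_pow_inv[OF trunc_dist_pos[OF z(1)] q(2)] by blast
      \<comment> \<open>Minimality makes every level \<open>k < m\<close> near, as
        \<open>l k \<ge> q ^ k \<ge> trunc_dist z\<close>, while \<open>q ^ m\<close> itself is
        below the distance.\<close>
      define m where "m = (LEAST m. q ^ m < trunc_dist z)"
      have m: "q ^ m < trunc_dist z"
        unfolding m_def using M by (rule LeastI)
      have m_le: "trunc_dist z \<le> q ^ k" if "k < m" for k
        using not_less_Least[of k "\<lambda>m. q ^ m < trunc_dist z"] that by (auto simp: m_def)
      have gauss: "(\<Sum>k<m. (real k + 1) / 32) \<ge> (real m)\<^sup>2 / 64" for m
        by (induction m) (auto simp: power2_eq_square field_simps)
      have "Re (F w) \<ge> - S + (real m)\<^sup>2 / 64"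
        using F_ge[OF z, of "{..<m}"] m_le q(3) True gauss[of m] by (smt (verit) finite_lessThan lessThan_iff)
      \<comment> \<open>The quadratic gain dominates any linear rate \<open>b\<close>, by expanding
        the square of \<open>m / 8 - 4 * b\<close>.\<close>
      moreover have "(real m)\<^sup>2 / 64 + 16 * b\<^sup>2 \<ge> real m * b"
        using zero_le_power2[of "real m / 8 - 4 * b"] by (simp add: power2_eq_square algebra_simps)
      ultimately have "norm (exp (- F w)) \<le> exp (S + 16 * b\<^sup>2 - real m * b)"
        by simp
      also have "\<dots> = C * (q ^ m) ^ n"
      proof -
        have e: "- (real m * b) = of_nat (m * n) * ln q"
          using q(1) by (simp add: b_def ln_div)
        have "exp (- (real m * b)) = (q ^ m) ^ n"
          using q(1) by (simp only: e exp_of_nat_mult) (simp add: power_mult)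
        then show ?thesis
          by (simp add: C_def exp_diff exp_add exp_minus divide_inverse)
      qed
      also have "\<dots> \<le> C * trunc_dist z ^ n"
        using m q(1) by (intro mult_left_mono power_mono) (auto simp: C_def)
      finally show ?thesis .
    qed
    then show "\<exists>C. \<forall>z\<in>right_half_plane. \<forall>w\<in>nbhd z. norm (exp (- F w)) \<le> C * trunc_dist z ^ n"
      by blast
  qed
qed

end

text \<open>The construction of \<open>F\<close> and \<open>G\<close> is common to
  \<open>s < 1\<close> and \<open>s = 1\<close>. The cases differ in the lengths and in the metric
  property of the Cantor set, which enter as hypotheses.\<close>

lemma (in cantor_lengths) ex_smooth_pair_vanishing_on_cantor_set:
  assumes q: "0 < q" "q < 1" "\<And>k. q ^ k \<le> l k"
    and sum_l: "summable (\<lambda>k. (real k + 1) * 2 ^ k * l k)"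
    and measure: "s < 1 \<Longrightarrow> hausdorff_measure s cantor_set = 1"
    and dim: "s = 1 \<Longrightarrow> hausdorff_dim cantor_set = 1"
  shows "\<exists>(E :: real set) (F :: complex \<Rightarrow> complex) (G :: complex \<Rightarrow> complex).
    nowhere_dense E \<and> compact E \<and> cantor_type E \<and> E \<subseteq> {0..1} \<and>
    (s < 1 \<longrightarrow> hausdorff_measure s E = 1) \<and>
    (s = 1 \<longrightarrow> hausdorff_dim E = 1) \<and>
    F holomorphic_on right_half_plane \<and>
    G holomorphic_on right_half_plane \<and>
    (\<exists>z\<in>right_half_plane. G z \<noteq> 0) \<and>
    admits_smooth_extension (\<lambda>z. exp (- F z)) \<and>
    admits_smooth_extension (\<lambda>z. G z * exp (- F z)) \<and>
    (\<forall>z \<in> (\<lambda>y. - \<i> * complex_of_real y) ` E.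
       vanishes_to_infinite_order (\<lambda>z. exp (- F z)) z \<and>
       vanishes_to_infinite_order (\<lambda>z. G z * exp (- F z)) z \<and>
       (\<exists>w :: nat \<Rightarrow> complex.
          (\<forall>k. w k \<in> right_half_plane \<and> G (w k) * exp (- F (w k)) = 0) \<and>
          w \<longlonglongrightarrow> z))"
proof -
  define \<iota> where "\<iota> y = - \<i> * complex_of_real y" for y
  define K where "K = \<iota> ` cantor_set"
  \<comment> \<open>Being an isometry, \<iota> carries the net of left ends over to
    \<open>K\<close>.\<close>
  have dist_\<iota>: "dist (\<iota> x) (\<iota> y) = \<bar>x - y\<bar>" for x y
    by (simp add: \<iota>_def dist_norm norm_mult norm_minus_commute abs_minus_commute
        flip: right_diff_distrib of_real_diff)
  have "compact K"
    unfolding K_def \<iota>_def by (intro compact_continuous_image compact_cantor_set continuous_intros)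
  moreover have "\<iota> 0 \<in> K"
    using left_end_in_cantor_set[of 0 0] by (auto simp: K_def)
  ultimately interpret boundary_set K
    by unfold_locales (auto intro: compact_imp_closed simp: K_def \<iota>_def)
  obtain G B where G: "\<And>z. z \<in> right_half_plane \<Longrightarrow> G holomorphic_on nbhd z"
    "\<And>z w. z \<in> right_half_plane \<Longrightarrow> w \<in> nbhd z \<Longrightarrow> norm (G w) \<le> B"
    "\<exists>z\<in>right_half_plane. G z \<noteq> 0"
    "\<And>p. p \<in> K \<Longrightarrow> \<exists>w. (\<forall>k. w k \<in> right_half_plane \<and> G (w k) = 0) \<and> w \<longlonglongrightarrow> p"
    using ex_Blaschke_product by blast
  have in_K: "\<iota> (left_end k i) \<in> K" if "i < 2 ^ k" for k i
    using left_end_in_cantor_set[OF that] by (simp add: K_def)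
  have net: "\<exists>i<2 ^ k. dist y (\<iota> (left_end k i)) \<le> l k" if "y \<in> K" for y k
    using that cantor_set_net dist_\<iota> by (auto simp: K_def)
  obtain F where F: "\<And>z. z \<in> right_half_plane \<Longrightarrow> F holomorphic_on nbhd z"
    "\<And>n. \<exists>C. \<forall>z\<in>right_half_plane. \<forall>w\<in>nbhd z. norm (exp (- F w)) \<le> C * trunc_dist z ^ n"
    using ex_rapidly_decaying_exp[OF in_K net q sum_l] by blast
  have "\<exists>h. smooth_extension (\<lambda>z. exp (- F z)) h \<and> (\<forall>n. \<forall>p\<in>K. h n p = 0)"
    by (intro smooth_extension_if_rapidly_decaying F(2) holomorphic_intros F(1))
  moreover have "\<exists>h. smooth_extension (\<lambda>z. G z * exp (- F z)) h \<and> (\<forall>n. \<forall>p\<in>K. h n p = 0)"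
  proof (intro smooth_extension_if_rapidly_decaying)
    show "(\<lambda>z. G z * exp (- F z)) holomorphic_on nbhd z" if "z \<in> right_half_plane" for z
      by (intro holomorphic_intros F(1) G(1) that)
    fix n
    obtain C where C: "\<And>z w. z \<in> right_half_plane \<Longrightarrow> w \<in> nbhd z \<Longrightarrow> norm (exp (- F w)) \<le> C * trunc_dist z ^ n"
      using F(2) by blast
    have "norm (G w * exp (- F w)) \<le> B * C * trunc_dist z ^ n" if "z \<in> right_half_plane" "w \<in> nbhd z" for z w
      using mult_mono'[OF G(2)[OF that] C[OF that]] by (simp add: norm_mult mult.assoc)
    then show "\<exists>C. \<forall>z\<in>right_half_plane. \<forall>w\<in>nbhd z. norm (G w * exp (- F w)) \<le> C * trunc_dist z ^ n"
      by blast
  qed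
  ultimately have "admits_smooth_extension (\<lambda>z. exp (- F z))"
      "admits_smooth_extension (\<lambda>z. G z * exp (- F z))"
      "\<forall>p\<in>K. vanishes_to_infinite_order (\<lambda>z. exp (- F z)) p"
      "\<forall>p\<in>K. vanishes_to_infinite_order (\<lambda>z. G z * exp (- F z)) p"
    using Re_K unfolding admits_smooth_extension_def vanishes_to_infinite_order_def
      frontier_right_half_plane by blast+
  moreover have "F holomorphic_on right_half_plane" "G holomorphic_on right_half_plane"
    using F(1) G(1) by (auto intro: holomorphic_on_right_half_planeI)
  moreover have "\<forall>p\<in>K. \<exists>w. (\<forall>k. w k \<in> right_half_plane \<and> G (w k) * exp (- F (w k)) = 0) \<and> w \<longlonglongrightarrow> p"
    using G(4) by simp
  \<comment> \<open>The quantities \<open>2 ^ k * l k\<close> are dominated by the terms of a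
    convergent series, so they tend to 0.\<close>
  moreover have "nowhere_dense cantor_set"
  proof (rule nowhere_dense_cantor_set,
      rule real_tendsto_sandwich[OF _ _ tendsto_const summable_LIMSEQ_zero[OF sum_l]])
    have "2 ^ k * l k \<le> (real k + 1) * (2 ^ k * l k)" for k
      using mult_right_mono[of 1 "real k + 1" "2 ^ k * l k"] l_pos[of k] by simp
    then show "\<forall>\<^sub>F k in sequentially. 2 ^ k * l k \<le> (real k + 1) * 2 ^ k * l k"
      by (simp add: mult.assoc)
    show "\<forall>\<^sub>F k in sequentially. 0 \<le> 2 ^ k * l k"
      using l_pos less_imp_le by (intro always_eventually allI mult_nonneg_nonneg) auto
  qed
  moreover have "(\<lambda>y. - \<i> * complex_of_real y) ` cantor_set = K"
    by (simp add: K_def \<iota>_def)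
  ultimately show ?thesis
    using compact_cantor_set cantor_type_cantor_set cantor_set_subset measure dim G(3)
    by (intro exI[of _ cantor_set] exI[of _ F] exI[of _ G]) (simp only:, blast)
qed

section \<open>Choice of the Cantor set in the two cases\<close>

theorem lemma0p1:
  fixes s :: real
  assumes "0 < s" and "s \<le> 1"
  shows "\<exists>(E :: real set) (F :: complex \<Rightarrow> complex) (G :: complex \<Rightarrow> complex).
    nowhere_dense E \<and> compact E \<and> cantor_type E \<and> E \<subseteq> {0..1} \<and>
    (s < 1 \<longrightarrow> hausdorff_measure s E = 1) \<and>
    (s = 1 \<longrightarrow> hausdorff_dim E = 1) \<and>
    F holomorphic_on right_half_plane \<and>
    G holomorphic_on right_half_plane \<and>
    (\<exists>z\<in>right_half_plane. G z \<noteq> 0) \<and>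
    admits_smooth_extension (\<lambda>z. exp (- F z)) \<and>
    admits_smooth_extension (\<lambda>z. G z * exp (- F z)) \<and>
    (\<forall>z \<in> (\<lambda>y. - \<i> * complex_of_real y) ` E.
       vanishes_to_infinite_order (\<lambda>z. exp (- F z)) z \<and>
       vanishes_to_infinite_order (\<lambda>z. G z * exp (- F z)) z \<and>
       (\<exists>w :: nat \<Rightarrow> complex.
          (\<forall>k. w k \<in> right_half_plane \<and> G (w k) * exp (- F (w k)) = 0) \<and>
          w \<longlonglongrightarrow> z))"
proof (cases "s < 1")
  case True
  \<comment> \<open>This solves \<open>2 * r powr s = 1\<close>, so the weights of the two halves
    add up to that of the whole.\<close>
  define r :: real where "r = (1 / 2) powr (1 / s)"
  interpret self_similar_cantor s r
    using assms(1) True by unfold_locales (auto simp: r_def powr_powr)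
  show ?thesis
    using r_less_half True
    by (intro ex_smooth_pair_vanishing_on_cantor_set[OF r(1) _ order_refl summable_lengths]
        hausdorff_measure_eq_1) auto
next
  case False
  then have s: "s = 1"
    using assms(2) by simp
  \<comment> \<open>From \<open>k + 1 \<le> 2 ^ k\<close> the cubic factor is at most
    \<open>8 ^ k\<close>, and together with \<open>2 ^ k\<close> this gives base 16.\<close>
  have q: "(1 / 16) ^ k \<le> thick_length k" for k
  proof -
    have "(real k + 1) ^ 3 \<le> (2 ^ k) ^ 3"
      using of_nat_mono[OF Suc_leI[OF less_exp[of k]], where 'a = real] by (intro power_mono) auto
    then have "2 ^ k * (real k + 1) ^ 3 \<le> 2 ^ k * (2 ^ k) ^ 3"
      by (intro mult_left_mono) auto
    also have "\<dots> = 2 ^ (4 * k)"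
      by (simp flip: power_mult power_add)
    also have "\<dots> = 16 ^ k"
      by (simp add: power_mult)
    finally show ?thesis
      unfolding thick_length_def power_one_over by (intro divide_left_mono) auto
  qed
  show ?thesis
    using s q summable_thick_length hausdorff_dim_thick
    by (intro thick.ex_smooth_pair_vanishing_on_cantor_set[of "1 / 16"]) auto
qed

end
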